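(* Assume $A$ is associative. Let $\Omega\subseteq V$ be a $T$-slice domain and let $f,g:\Omega\to A$ be $T$-regular functions. If there exists $J\in\mathbb{T}$ such that the $J$-slice $\Omega_J$ (whose dimension is $t_0+\tau+1$) contains a set of Hausdorff dimension $s\ge t_0+\tau$ where $f_J$ and $g_J$ coincide, then $f=g$ throughout $\Omega$.
   Context: $\mathbb{N}$ includes $0$. $A$ is a finite-dimensional alternative (unital) real $*$-algebra: a finite-dimensional real vector space with an $\mathbb{R}$-bilinear multiplication such that $x(xy)=x^2y$, $(xy)y=xy^2$ (automatic if $A$ is associative), and with an involutive real-linear antiautomorphism $x\mapsto x^c$; $\mathbb{R}$ is identified with $\mathbb{R}1$. Set $t(x)=x+x^c$, $n(x)=xx^c$, $\mathbb{S}_A=\{x\in A:t(x)=0,\ n(x)=1\}$, assumed nonempty. Let $Q_A=\bigcup_{J\in\mathbb{S}_A}(\mathbb{R}+J\mathbb{R})$. A hypercomplex subspace of $A$ is a real vector subspace $V$ with $\mathbb{R}\subsetneq V\subseteq Q_A$; a hypercomplex basis of $V$ is an ordered real basis $(v_0,\ldots,v_n)$ with $n\ge1$, $v_0=1$, $v_s\in\mathbb{S}_A$ and $v_sv_u=-v_uv_s$ for distinct $s,u\in\{1,\ldots,n\}$. Setting. $V$ is a hypercomplex subspace of $A$ with hypercomplex basis $\mathcal{B}=(v_0,\ldots,v_n)$, completed to a real basis $\mathcal{B}'=(v_0,\ldots,v_d)$ of $A$; $\langle\cdot,\cdot\rangle$ and $\|\cdot\|$ are the Euclidean scalar product and norm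 on $A$ making $\mathcal{B}'$ orthonormal. A domain is a nonempty connected open subset. Fix $\tau\in\{0,\ldots,n\}$ and a list of steps $T=(t_0,\ldots,t_\tau)\in\mathbb{N}^{\tau+1}$ with $0\le t_0<t_1<\cdots<t_\tau=n$. For $0\le\ell\le m\le n$, $\mathbb{R}_{\ell,m}=\mathrm{Span}(v_\ell,\ldots,v_m)$ and $\mathbb{S}_{\ell,m}$ is its unit sphere. The mirror is $\mathbb{R}_{0,t_0}$; the $T$-torus is $\mathbb{T}=\mathbb{S}_{t_0+1,t_1}\times\cdots\times\mathbb{S}_{t_{\tau-1}+1,t_\tau}$ if $\tau\ge1$. For $J=(J_1,\ldots,J_\tau)\in\mathbb{T}$, $\mathcal{B}_J=(v_0,v_1,\ldots,v_{t_0},J_1,\ldots,J_\tau)$ and $\mathbb{R}_J^{t_0+\tau+1}=\mathrm{Span}(\mathcal{B}_J)$, with elements written $x_0+v_1x_1+\cdots+v_{t_0}x_{t_0}+\beta_1J_1+\cdots+\beta_\tau J_\tau$. If $\tau=0$, "$J\in\mathbb{T}$" is read as $J=\emptyset$, with $\mathcal{B}_\emptyset=\mathcal{B}$ and $\mathbb{R}_\emptyset^{t_0+1}=V$. For $Y\subseteq V$ and $f:Y\to A$: $Y_J=Y\cap\mathbb{R}_J^{t_0+\tau+1}$ (the $J$-slice of $Y$) and $f_J=f|_{Y_J}$. A function $f:\Omega\to A$ on a domain $\Omega\subseteq V$ is $T$-regular if for every $J\in\mathbb{T}$ the restriction $f_J$ is $J$-monogenic, i.e. of class $\mathscr{C}^1$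 on the open subset $\Omega_J$ of $\mathbb{R}_J^{t_0+\tau+1}$ with $(\partial_{x_0}+v_1\partial_{x_1}+\cdots+v_{t_0}\partial_{x_{t_0}}+J_1\partial_{\beta_1}+\cdots+J_\tau\partial_{\beta_\tau})f_J\equiv0$ (vacuous if $\Omega_J=\emptyset$). A domain $\Omega\subseteq V$ is a $T$-slice domain if it intersects the mirror $\mathbb{R}_{0,t_0}$ and if, for every $J\in\mathbb{T}$, the slice $\Omega_J$ is connected. *)

theory Defs
  imports "HOL-Analysis.Analysis"
begin

section \<open>Hausdorff measure and Hausdorff dimension\<close>

text \<open>The summand for a covering set, with the usual conventions at exponent 0, where the library
  function powr would give \<open>0 powr 0 = 0\<close>.\<close>
definition hausdorff_weight :: "real \<Rightarrow> 'a::metric_space set \<Rightarrow> ennreal" where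
  "hausdorff_weight s U =
     (if U = {} then 0 else if s = 0 then 1 else ennreal (diameter U powr s))"

text \<open>Boundedness has to be required separately: the library's \<^const>\<open>diameter\<close> is an unspecified real
  number on unbounded sets.\<close>
definition hausdorff_premeasure :: "real \<Rightarrow> real \<Rightarrow> 'a::metric_space set \<Rightarrow> ennreal" where
  "hausdorff_premeasure s \<delta> E =
     (INF U \<in> {U :: nat \<Rightarrow> 'a set. E \<subseteq> (\<Union>i. U i) \<and> (\<forall>i. bounded (U i) \<and> diameter (U i) \<le> \<delta>)}.
        (\<Sum>i. hausdorff_weight s (U i)))"

text \<open>Not normalised to agree with Lebesgue measure; the constant does not affect the dimension.\<close>
definition hausdorff_measure :: "real \<Rightarrow> 'a::metric_space set \<Rightarrow> ennreal" where
  "hausdorff_measure s E = (SUP \<delta> \<in> {0<..}. hausdorff_premeasure s \<delta> E)"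

definition hausdorff_dim :: "'a::metric_space set \<Rightarrow> ennreal" where
  "hausdorff_dim E = (INF s \<in> {s. 0 \<le> s \<and> hausdorff_measure s E = 0}. ennreal s)"


section \<open>Real *-algebras and hypercomplex subspaces\<close>

definition star_involution :: "('a::real_algebra_1 \<Rightarrow> 'a) \<Rightarrow> bool" where
  "star_involution c \<longleftrightarrow>
     linear c \<and> (\<forall>x. c (c x) = x) \<and> (\<forall>x y. c (x * y) = c y * c x)"

definition alg_trace :: "('a::real_algebra_1 \<Rightarrow> 'a) \<Rightarrow> 'a \<Rightarrow> 'a" where
  "alg_trace c x = x + c x"

definition alg_norm :: "('a::real_algebra_1 \<Rightarrow> 'a) \<Rightarrow> 'a \<Rightarrow> 'a" where
  "alg_norm c x = x * c x"

definition imag_units :: "('a::real_algebra_1 \<Rightarrow> 'a) \<Rightarrow> 'a set" where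
  "imag_units c = {x. alg_trace c x = 0 \<and> alg_norm c x = 1}"

definition quadratic_cone :: "('a::real_algebra_1 \<Rightarrow> 'a) \<Rightarrow> 'a set" where
  "quadratic_cone c = (\<Union>J \<in> imag_units c. {of_real a + J * of_real b | a b. True})"

text \<open>Here \<open>\<real>\<close> is the library's copy of the real line inside the algebra, the range of
  \<^const>\<open>of_real\<close>.\<close>
definition hypercomplex_subspace :: "('a::real_algebra_1 \<Rightarrow> 'a) \<Rightarrow> 'a set \<Rightarrow> bool" where
  "hypercomplex_subspace c V \<longleftrightarrow> subspace V \<and> \<real> \<subset> V \<and> V \<subseteq> quadratic_cone c"

text \<open>The family \<open>v 0, \<dots>, v m\<close> is an ordered real basis of \<open>W\<close>.\<close>
definition ordered_basis :: "'a::real_vector set \<Rightarrow> nat \<Rightarrow> (nat \<Rightarrow> 'a) \<Rightarrow> bool" where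
  "ordered_basis W m v \<longleftrightarrow>
     inj_on v {..m} \<and> independent (v ` {..m}) \<and> span (v ` {..m}) = W"

definition hypercomplex_basis ::
  "('a::real_algebra_1 \<Rightarrow> 'a) \<Rightarrow> 'a set \<Rightarrow> nat \<Rightarrow> (nat \<Rightarrow> 'a) \<Rightarrow> bool" where
  "hypercomplex_basis c V n v \<longleftrightarrow>
     ordered_basis V n v \<and> 1 \<le> n \<and> v 0 = 1 \<and> (\<forall>s\<in>{1..n}. v s \<in> imag_units c) \<and>
     (\<forall>s\<in>{1..n}. \<forall>u\<in>{1..n}. s \<noteq> u \<longrightarrow> v s * v u = - (v u * v s))"

text \<open>\<open>v 0, \<dots>, v d\<close> is a basis of the whole algebra, and the inner product of the type (hence its
  norm and topology) is the one that makes this basis orthonormal.\<close>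
definition orthonormal_basis :: "nat \<Rightarrow> (nat \<Rightarrow> 'a::euclidean_space) \<Rightarrow> bool" where
  "orthonormal_basis d v \<longleftrightarrow>
     ordered_basis UNIV d v \<and> (\<forall>i\<le>d. \<forall>j\<le>d. v i \<bullet> v j = (if i = j then 1 else 0))"


section \<open>Mirror, torus and slices\<close>

text \<open>The list of steps \<open>(t 0, \<dots>, t \<tau>)\<close>; values of \<open>t\<close> beyond \<open>\<tau>\<close> are irrelevant.\<close>
definition step_list :: "nat \<Rightarrow> nat \<Rightarrow> (nat \<Rightarrow> nat) \<Rightarrow> bool" where
  "step_list n \<tau> t \<longleftrightarrow> \<tau> \<le> n \<and> strict_mono_on {..\<tau>} t \<and> t \<tau> = n"

definition subspan :: "(nat \<Rightarrow> 'a::euclidean_space) \<Rightarrow> nat \<Rightarrow> nat \<Rightarrow> 'a set" where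
  "subspan v l m = span (v ` {l..m})"

definition subsphere :: "(nat \<Rightarrow> 'a::euclidean_space) \<Rightarrow> nat \<Rightarrow> nat \<Rightarrow> 'a set" where
  "subsphere v l m = {x \<in> subspan v l m. norm x = 1}"

definition mirror :: "(nat \<Rightarrow> 'a::euclidean_space) \<Rightarrow> (nat \<Rightarrow> nat) \<Rightarrow> 'a set" where
  "mirror v t = subspan v 0 (t 0)"

text \<open>Tuples \<open>(J 1, \<dots>, J \<tau>)\<close> are extensional functions on \<open>{1..\<tau>}\<close>; for \<open>\<tau> = 0\<close> there is exactly
  one, the empty tuple.\<close>
definition torus ::
  "(nat \<Rightarrow> 'a::euclidean_space) \<Rightarrow> nat \<Rightarrow> (nat \<Rightarrow> nat) \<Rightarrow> (nat \<Rightarrow> 'a) set" where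
  "torus v \<tau> t = (\<Pi>\<^sub>E h\<in>{1..\<tau>}. subsphere v (t (h - 1) + 1) (t h))"

definition slice_space ::
  "(nat \<Rightarrow> 'a::euclidean_space) \<Rightarrow> nat \<Rightarrow> (nat \<Rightarrow> nat) \<Rightarrow> (nat \<Rightarrow> 'a) \<Rightarrow> 'a set" where
  "slice_space v \<tau> t J = span (v ` {..t 0} \<union> J ` {1..\<tau>})"

definition slice ::
  "(nat \<Rightarrow> 'a::euclidean_space) \<Rightarrow> nat \<Rightarrow> (nat \<Rightarrow> nat) \<Rightarrow> (nat \<Rightarrow> 'a) \<Rightarrow> 'a set \<Rightarrow> 'a set" where
  "slice v \<tau> t J Y = Y \<inter> slice_space v \<tau> t J"

definition domain_in :: "'a::euclidean_space set \<Rightarrow> 'a set \<Rightarrow> bool" where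
  "domain_in V \<Omega> \<longleftrightarrow> \<Omega> \<noteq> {} \<and> connected \<Omega> \<and> openin (top_of_set V) \<Omega>"

definition slice_domain ::
  "'a::euclidean_space set \<Rightarrow> (nat \<Rightarrow> 'a) \<Rightarrow> nat \<Rightarrow> (nat \<Rightarrow> nat) \<Rightarrow> 'a set \<Rightarrow> bool" where
  "slice_domain V v \<tau> t \<Omega> \<longleftrightarrow>
     domain_in V \<Omega> \<and> \<Omega> \<inter> mirror v t \<noteq> {} \<and>
     (\<forall>J \<in> torus v \<tau> t. connected (slice v \<tau> t J \<Omega>))"


section \<open>Regular functions\<close>

text \<open>Class \<open>C\<^sup>1\<close> on a set \<open>U\<close> that is open in the subspace \<open>W\<close>. The derivative is taken within \<open>U\<close>,
  so it sees only the restriction of \<open>f\<close> to \<open>U\<close>, and it is determined only along \<open>W\<close>.\<close>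
definition C1_on :: "'a::euclidean_space set \<Rightarrow> 'a set \<Rightarrow> ('a \<Rightarrow> 'b::real_normed_vector) \<Rightarrow> bool" where
  "C1_on W U f \<longleftrightarrow>
     (\<exists>D. (\<forall>x\<in>U. (f has_derivative D x) (at x within U)) \<and>
          (\<forall>w\<in>W. continuous_on U (\<lambda>x. D x w)))"

text \<open>If \<open>U\<close> is open in a subspace containing \<open>w\<close> and \<open>x \<in> U\<close>, this is the partial derivative at \<open>x\<close>
  of the restriction of \<open>f\<close> to \<open>U\<close> in the coordinate belonging to the basis vector \<open>w\<close>.\<close>
definition partial_deriv ::
  "('a::euclidean_space \<Rightarrow> 'b::real_normed_vector) \<Rightarrow> 'a \<Rightarrow> 'a \<Rightarrow> 'b" where
  "partial_deriv f w x = vector_derivative (\<lambda>r. f (x + r *\<^sub>R w)) (at 0)"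

text \<open>The summand with \<open>s = 0\<close> is the derivative in \<open>x\<^sub>0\<close>, since \<open>v 0 = 1\<close>.\<close>
definition slice_CR ::
  "(nat \<Rightarrow> 'a::{real_algebra_1,euclidean_space}) \<Rightarrow> nat \<Rightarrow> (nat \<Rightarrow> nat) \<Rightarrow> (nat \<Rightarrow> 'a) \<Rightarrow>
     ('a \<Rightarrow> 'a) \<Rightarrow> 'a \<Rightarrow> 'a" where
  "slice_CR v \<tau> t J f x =
     (\<Sum>s\<le>t 0. v s * partial_deriv f (v s) x) + (\<Sum>h=1..\<tau>. J h * partial_deriv f (J h) x)"

definition slice_monogenic ::
  "(nat \<Rightarrow> 'a::{real_algebra_1,euclidean_space}) \<Rightarrow> nat \<Rightarrow> (nat \<Rightarrow> nat) \<Rightarrow> (nat \<Rightarrow> 'a) \<Rightarrow>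
     'a set \<Rightarrow> ('a \<Rightarrow> 'a) \<Rightarrow> bool" where
  "slice_monogenic v \<tau> t J \<Omega> f \<longleftrightarrow>
     C1_on (slice_space v \<tau> t J) (slice v \<tau> t J \<Omega>) f \<and>
     (\<forall>x \<in> slice v \<tau> t J \<Omega>. slice_CR v \<tau> t J f x = 0)"

definition T_regular ::
  "(nat \<Rightarrow> 'a::{real_algebra_1,euclidean_space}) \<Rightarrow> nat \<Rightarrow> (nat \<Rightarrow> nat) \<Rightarrow>
     'a set \<Rightarrow> ('a \<Rightarrow> 'a) \<Rightarrow> bool" where
  "T_regular v \<tau> t \<Omega> f \<longleftrightarrow> (\<forall>J \<in> torus v \<tau> t. slice_monogenic v \<tau> t J \<Omega> f)"

end

theory Submission
  imports Defs
begin

text \<open>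
  Write \<open>m = t 0 + \<tau>\<close>, so that every slice space has dimension \<open>m + 1\<close>. Its standard basis
  consists of \<open>1\<close> and of anticommuting imaginary units, and is orthonormal. Two things have to
  be shown: a monogenic function on a slice that vanishes on a set of dimension at least \<open>m\<close>
  vanishes identically, and vanishing on one slice propagates to all the others.

  The algebra enters through a single identity. For a frame \<open>B\<close> with conjugation \<open>cj\<close>, the sum
  \<open>cj e * e' + cj e' * e\<close> is \<open>2\<close> if \<open>e = e'\<close> and \<open>0\<close> otherwise. Hence
  \<open>(\<Sum>e. cj e * (\<Sum>e'. e' * S e e'))\<close> collapses to the trace of \<open>S\<close> whenever \<open>S\<close> is symmetric
  (\<open>sum_conj_symmetric\<close>). Applied to second derivatives this is the factorisation of the
  Laplacian by the Cauchy-Riemann operator; applied to a rank one matrix it says that nonzero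
  vectors of the slice are invertible.

  The first use gives regularity. Functions are only known to be of class \<open>C\<^sup>1\<close>, so the
  Laplacian cannot be applied directly; instead its weak form shows that the average of \<open>H\<close>
  against a radial bump of radius \<open>\<epsilon>\<close> does not depend on \<open>\<epsilon>\<close> (\<open>mean_value_property\<close>). Moving
  derivatives to the bump makes all directional derivatives of \<open>H\<close> monogenic again and bounds
  them by \<open>H\<close> itself (\<open>gradient_estimate\<close>). Iterating that bound on shrinking balls controls
  derivatives of order \<open>k\<close> by a multiple of \<open>(C k)\<^sup>k\<close>, so Taylor expansion shows that a function
  with all derivatives zero at a point is zero near it, and on a connected set everywhere
  (\<open>flat_identity\<close>).

  The second use bounds zero sets. Suppose \<open>H\<close> is not identically zero. At a zero of \<open>H\<close> take a
  shortest nonvanishing iterated derivative, and let \<open>u\<close> be the derivative of one order less: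
  \<open>u\<close> is monogenic, vanishes at the point and has nonzero differential there. A differential
  annihilated by the Cauchy-Riemann operator cannot have rank one, so its kernel in the slice
  has dimension at most \<open>m - 1\<close> (\<open>dirac_kernel_dim\<close>). Near the point, zeros of \<open>u\<close> are then
  determined, in a Lipschitz way, by their projections to that kernel. Thus the zero set of \<open>H\<close>
  is a countable union of pieces that are null for the Hausdorff measure of every exponent above
  \<open>m - 1\<close> (\<open>zero_set_null\<close>), and the exponent \<open>m - 1/2\<close> contradicts the assumed dimension.

  For the propagation, change the tuple \<open>J\<close> one entry at a time. Two slices whose tuples differ
  in one entry share a hyperplane, and the domain meets it because it meets the mirror. A
  monogenic function that vanishes on an open piece of a hyperplane has vanishing tangential
  derivatives there, the Cauchy-Riemann equation kills the normal derivative, and by induction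
  all derivatives vanish (\<open>hyperplane_identity\<close>). Finally every point of \<open>V\<close> lies in some slice.
\<close>

section \<open>A radial bump and integration by parts\<close>

text \<open>Cut-offs of finite smoothness suffice, since at most two derivatives of them are taken.
  The advantage of truncated powers of \<open>1 - y \<bullet> y\<close> is that the radial field \<open>y\<close> times the bump
  of order \<open>k\<close> is, up to a constant, the gradient of the bump of order \<open>k + 1\<close>.\<close>
definition bump :: "nat \<Rightarrow> 'a::real_inner \<Rightarrow> real" where
  "bump k y = (max 0 (1 - y \<bullet> y)) ^ k"

definition dbump :: "nat \<Rightarrow> 'a::real_inner \<Rightarrow> 'a \<Rightarrow> real" where
  "dbump k w y = - 2 * real k * (y \<bullet> w) * bump (k - 1) y"

definition ddbump :: "nat \<Rightarrow> 'a::real_inner \<Rightarrow> 'a \<Rightarrow> 'a \<Rightarrow> real" where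
  "ddbump k w h y = - 2 * real k * ((h \<bullet> w) * bump (k - 1) y + (y \<bullet> w) * dbump (k - 1) h y)"

lemma has_real_derivative_pos_part_power:
  fixes s :: real
  assumes "2 \<le> k"
  shows "((\<lambda>s. (max 0 s) ^ k) has_real_derivative real k * (max 0 s) ^ (k - 1)) (at s)"
proof -
  consider "s > 0" | "s < 0" | "s = 0" by linarith
  then show ?thesis
  proof cases
    case 1
    have "((\<lambda>s. s ^ k) has_real_derivative real k * s ^ (k - 1)) (at s)"
      by (auto intro!: derivative_eq_intros)
    then have "((\<lambda>s. (max 0 s) ^ k) has_real_derivative real k * s ^ (k - 1)) (at s)"
      by (rule has_field_derivative_transform_within_open[where S = "{0<..}"]) (use 1 in auto)
    then show ?thesis using 1 by simp
  next
    case 2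
    have "((\<lambda>s::real. 0) has_real_derivative 0) (at s)" by simp
    then have "((\<lambda>s. (max 0 s) ^ k) has_real_derivative 0) (at s)"
      by (rule has_field_derivative_transform_within_open[where S = "{..<0}"]) (use 2 assms in auto)
    then show ?thesis using 2 assms by (simp add: power_0_left)
  next
    case 3
    have "((\<lambda>h::real. h ^ (k - 1)) \<longlongrightarrow> 0) (at 0)"
      using assms by (intro tendsto_eq_intros | simp)+
    then have lim: "((\<lambda>h::real. \<bar>h\<bar> ^ (k - 1)) \<longlongrightarrow> 0) (at 0)"
      by (auto dest: tendsto_rabs simp: power_abs)
    have "((\<lambda>h. (max 0 (0 + h) ^ k - max 0 0 ^ k) / h) \<longlongrightarrow> 0) (at (0::real))"
    proof (rule Lim_null_comparison[OF _ lim], rule always_eventually, intro allI)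
      fix h :: real
      obtain j where k: "k = Suc j" using assms by (cases k) auto
      then show "norm ((max 0 (0 + h) ^ k - max 0 0 ^ k) / h) \<le> \<bar>h\<bar> ^ (k - 1)"
        by (cases "h > 0") (auto simp: max_def)
    qed
    then show ?thesis using 3 assms by (simp add: DERIV_def power_0_left)
  qed
qed

lemma bump_zero: "1 \<le> norm y \<Longrightarrow> 0 < k \<Longrightarrow> bump k y = 0"
  using one_le_power[of "norm y" 2] by (simp add: bump_def max_def dot_square_norm del: one_le_power)

lemma bump_nonneg: "0 \<le> bump k y"
  by (simp add: bump_def)

lemma bump_le_1: "bump k y \<le> 1"
  by (simp add: bump_def power_le_one)

lemma has_derivative_bump:
  fixes y :: "'a::real_inner"
  assumes "2 \<le> k"
  shows "(bump k has_derivative (\<lambda>h. dbump k h y)) (at y)"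
proof -
  have "((\<lambda>y. (max 0 (1 - y \<bullet> y)) ^ k) has_derivative
      (\<lambda>h. (- 2 * (y \<bullet> h)) * (real k * (max 0 (1 - y \<bullet> y)) ^ (k - 1)))) (at y)"
    by (rule has_derivative_eq_rhs,
        rule DERIV_compose_FDERIV[OF has_real_derivative_pos_part_power[OF assms]])
       (auto intro!: derivative_eq_intros simp: inner_commute)
  then show ?thesis
    by (simp add: bump_def[abs_def] dbump_def mult_ac)
qed

lemma has_derivative_dbump:
  fixes y :: "'a::real_inner"
  assumes "3 \<le> k"
  shows "(dbump k w has_derivative (\<lambda>h. ddbump k w h y)) (at y)"
proof -
  have "((\<lambda>y. - 2 * real k * (y \<bullet> w)) has_derivative (\<lambda>h. - 2 * real k * (h \<bullet> w))) (at y)"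
    by (auto intro!: derivative_eq_intros)
  from has_derivative_mult[OF this has_derivative_bump[of "k - 1" y]] show ?thesis
    using assms by (simp add: dbump_def[abs_def] ddbump_def algebra_simps)
qed

lemma continuous_on_bump [continuous_intros]:
  "continuous_on S f \<Longrightarrow> continuous_on S (\<lambda>x. bump k (f x))"
  unfolding bump_def by (intro continuous_intros)

lemma continuous_on_dbump [continuous_intros]:
  "continuous_on S f \<Longrightarrow> continuous_on S (\<lambda>x. dbump k w (f x))"
  unfolding dbump_def by (intro continuous_intros)

lemma continuous_on_ddbump [continuous_intros]:
  "continuous_on S f \<Longrightarrow> continuous_on S (\<lambda>x. ddbump k w h (f x))"
  unfolding ddbump_def by (intro continuous_intros)

lemma dbump_zero: "1 \<le> norm y \<Longrightarrow> 2 \<le> k \<Longrightarrow> dbump k w y = 0"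
  by (simp add: dbump_def bump_zero)

lemma ddbump_zero: "1 \<le> norm y \<Longrightarrow> 3 \<le> k \<Longrightarrow> ddbump k w h y = 0"
  by (simp add: ddbump_def bump_zero dbump_zero)

lemma ddbump_commute: "ddbump k w h y = ddbump k h w y"
  by (simp add: ddbump_def dbump_def inner_commute algebra_simps)

lemma norm_dbump_le: "2 \<le> k \<Longrightarrow> norm (dbump k w y) \<le> 2 * real k * norm w"
proof -
  assume k: "2 \<le> k"
  show ?thesis
  proof (cases "1 \<le> norm y")
    case True
    then show ?thesis using k by (simp add: dbump_zero)
  next
    case False
    have "\<bar>y \<bullet> w\<bar> \<le> 1 * norm w"
      using Cauchy_Schwarz_ineq2[of y w] False mult_right_mono[of "norm y" 1 "norm w"] by simp
    then have "\<bar>y \<bullet> w\<bar> * bump (k - 1) y \<le> norm w * 1"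
      by (intro mult_mono) (auto simp: bump_nonneg bump_le_1)
    then have "2 * real k * (\<bar>y \<bullet> w\<bar> * bump (k - 1) y) \<le> 2 * real k * norm w"
      by (intro mult_left_mono) auto
    then show ?thesis
      by (simp add: dbump_def abs_mult bump_nonneg mult_ac)
  qed
qed

text \<open>The box contains the unit ball, which carries the bumps, with room for translations by
  vectors of norm at most one.\<close>
abbreviation bump_box :: "'a::euclidean_space set" where
  "bump_box \<equiv> cbox (- 2 *\<^sub>R One) (2 *\<^sub>R One)"

lemma norm_le_2_in_box:
  fixes y :: "'a::euclidean_space"
  assumes "norm y \<le> 2"
  shows "y \<in> bump_box"
proof -
  have "\<bar>y \<bullet> i\<bar> \<le> 2" if "i \<in> Basis" for i
    using Basis_le_norm[OF that, of y] assms by simp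
  then show ?thesis by (auto simp: mem_box abs_le_iff) (smt (verit))
qed

text \<open>Translating \<open>F\<close> along \<open>w\<close> does not change its integral as long as the support stays inside
  the box; differentiating under the integral sign gives the claim.\<close>
lemma integral_derivative_compact_support:
  fixes F :: "'a::euclidean_space \<Rightarrow> 'b::banach"
  assumes der: "\<And>y. (F has_derivative F' y) (at y)"
    and cont: "continuous_on UNIV (\<lambda>y. F' y w)"
    and supp: "\<And>y. norm y > 1 \<Longrightarrow> F y = 0"
  shows "integral bump_box (\<lambda>y. F' y w) = 0"
proof -
  have contF: "continuous_on S F" for S
    using der by (meson continuous_at_imp_continuous_on has_derivative_continuous)
  \<comment> \<open>The radius up to which translations along \<open>w\<close> have norm at most one.\<close>
  define \<rho> where "\<rho> = 1 / (1 + norm w)"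
  have \<rho>: "\<rho> > 0" by (simp add: \<rho>_def add_pos_nonneg)
  have small: "norm (r *\<^sub>R w) \<le> 1" if "r \<in> {-\<rho><..<\<rho>}" for r
  proof -
    have "\<bar>r\<bar> * norm w \<le> \<rho> * (1 + norm w)"
      using that by (intro mult_mono) auto
    also have "\<dots> = 1" by (simp add: \<rho>_def add_pos_nonneg) (smt (verit) norm_ge_zero)
    finally show ?thesis by simp
  qed
  define I where "I = integral bump_box F"
  have I: "(F has_integral integral (cbox (- 2 *\<^sub>R One + c) (2 *\<^sub>R One + c)) F) UNIV"
    if c: "norm c \<le> 1" for c
  proof (rule has_integral_on_superset)
    show "(F has_integral integral (cbox (- 2 *\<^sub>R One + c) (2 *\<^sub>R One + c)) F)
        (cbox (- 2 *\<^sub>R One + c) (2 *\<^sub>R One + c))"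
      by (intro integrable_integral integrable_continuous contF)
    fix y assume y: "y \<notin> cbox (- 2 *\<^sub>R One + c) (2 *\<^sub>R One + c)"
    show "F y = 0"
    proof (rule supp, rule ccontr)
      assume "\<not> 1 < norm y"
      then have "norm (y - c) \<le> 2" using c norm_triangle_ineq4[of y c] by linarith
      then have "y - c \<in> bump_box" by (rule norm_le_2_in_box)
      then have "y \<in> cbox (- 2 *\<^sub>R One + c) (2 *\<^sub>R One + c)"
        by (simp add: mem_box inner_diff_left inner_add_left) (smt (verit))
      then show False using y by simp
    qed
  qed simp
  have same: "integral (cbox (- 2 *\<^sub>R One + c) (2 *\<^sub>R One + c)) F = I" if "norm c \<le> 1" for c
    using has_integral_unique[OF I[OF that] I[of 0]] by (simp add: I_def)
  have const: "integral bump_box (\<lambda>y. F (y + r *\<^sub>R w)) = I" if "r \<in> {-\<rho><..<\<rho>}" for r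
    using integral_shift_cbox_plus[of "- 2 *\<^sub>R One" "2 *\<^sub>R One" F "r *\<^sub>R w"] same[OF small[OF that]]
    by (simp add: o_def add.commute)
  have "((\<lambda>r. integral bump_box (\<lambda>y. F (y + r *\<^sub>R w))) has_vector_derivative
      integral bump_box (\<lambda>y. F' (y + 0 *\<^sub>R w) w)) (at 0 within UNIV)"
  proof (rule leibniz_rule_vector_derivative)
    show "((\<lambda>r. F (y + r *\<^sub>R w)) has_vector_derivative F' (y + r *\<^sub>R w) w) (at r within UNIV)" for r y
    proof -
      have "((\<lambda>r. F (y + r *\<^sub>R w)) has_derivative (\<lambda>h. F' (y + r *\<^sub>R w) (h *\<^sub>R w))) (at r)"
        by (rule has_derivative_compose[OF _ der]) (auto intro!: derivative_eq_intros)
      moreover have "F' (y + r *\<^sub>R w) (h *\<^sub>R w) = h *\<^sub>R F' (y + r *\<^sub>R w) w" for h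
        using has_derivative_linear[OF der] by (simp add: linear_cmul)
      ultimately show ?thesis by (simp add: has_vector_derivative_def)
    qed
    show "(\<lambda>y. F (y + r *\<^sub>R w)) integrable_on bump_box" for r
      by (intro integrable_continuous continuous_on_compose2[OF contF] continuous_intros) auto
    show "continuous_on (UNIV \<times> bump_box) (\<lambda>(r, y). F' (y + r *\<^sub>R w) w)"
      unfolding case_prod_beta
      by (rule continuous_on_compose2[OF cont]) (auto intro!: continuous_intros)
  qed auto
  moreover have "((\<lambda>r. integral bump_box (\<lambda>y. F (y + r *\<^sub>R w))) has_vector_derivative 0) (at 0)"
    by (rule has_vector_derivative_transform_within_open[of "\<lambda>_. I" _ _ "{-\<rho><..<\<rho>}"])
       (use \<rho> const in auto)
  ultimately have "integral bump_box (\<lambda>y. F' (y + 0 *\<^sub>R w) w) = 0"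
    by (rule vector_derivative_unique_at)
  then show ?thesis by simp
qed

text \<open>The function \<open>H\<close> is defined near the box only, but its product with \<open>\<psi>\<close> extends by zero to
  a function of class \<open>C\<^sup>1\<close> on the whole space, whose derivative has integral zero.\<close>
lemma integral_by_parts_box:
  fixes H :: "'a::euclidean_space \<Rightarrow> 'b::banach" and D :: "'a \<Rightarrow> 'a \<Rightarrow>\<^sub>L 'b"
  assumes U: "open U" and H: "\<And>z. z \<in> U \<Longrightarrow> (H has_derivative D z) (at z)"
    and D: "continuous_on U D"
    and \<psi>: "\<And>y. (\<psi> has_derivative \<psi>' y) (at y)" and \<psi>': "continuous_on UNIV (\<lambda>y. \<psi>' y w)"
    and supp: "\<And>y. norm y > 1 \<Longrightarrow> \<psi> y = 0" "\<And>y. norm y > 1 \<Longrightarrow> \<psi>' y w = 0"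
    and sub: "\<And>y. y \<in> bump_box \<Longrightarrow> x + \<epsilon> *\<^sub>R y \<in> U"
  shows "integral bump_box (\<lambda>y. \<psi>' y w *\<^sub>R H (x + \<epsilon> *\<^sub>R y)) =
    - \<epsilon> *\<^sub>R integral bump_box (\<lambda>y. \<psi> y *\<^sub>R D (x + \<epsilon> *\<^sub>R y) w)"
proof -
  define F where "F = (\<lambda>y. \<psi> y *\<^sub>R H (x + \<epsilon> *\<^sub>R y))"
  \<comment> \<open>Far from the unit ball \<open>x + \<epsilon> *\<^sub>R y\<close> may leave \<open>U\<close>, where nothing is known about \<open>H\<close>.\<close>
  define F' where "F' = (\<lambda>y h. if norm y > 1 then 0 else
     \<psi> y *\<^sub>R D (x + \<epsilon> *\<^sub>R y) (\<epsilon> *\<^sub>R h) + \<psi>' y h *\<^sub>R H (x + \<epsilon> *\<^sub>R y))"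
  have inU: "x + \<epsilon> *\<^sub>R y \<in> U" if "norm y < 2" for y
    using sub[OF norm_le_2_in_box] that by simp
  have contH: "continuous_on U H"
    using H by (meson continuous_at_imp_continuous_on has_derivative_continuous)
  have cont\<psi>: "continuous_on S \<psi>" for S
    using \<psi> by (meson continuous_at_imp_continuous_on has_derivative_continuous)
  have cont_shift: "continuous_on S (\<lambda>y. x + \<epsilon> *\<^sub>R y)" for S by (intro continuous_intros)
  have op: "open {y::'a. norm y > 1}"
    by (intro open_Collect_less continuous_intros)
  have Fder: "(F has_derivative F' y) (at y)" for y
  proof (cases "norm y > 1")
    case True
    have "((\<lambda>_. 0) has_derivative (\<lambda>_. 0)) (at y)" by simp
    then have "(F has_derivative (\<lambda>_. 0)) (at y)"
      by (rule has_derivative_transform_within_open[OF _ op]) (use True supp in \<open>auto simp: F_def\<close>)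
    then show ?thesis using True by (simp add: F'_def)
  next
    case False
    have "((\<lambda>y. H (x + \<epsilon> *\<^sub>R y)) has_derivative (\<lambda>h. D (x + \<epsilon> *\<^sub>R y) (\<epsilon> *\<^sub>R h))) (at y)"
      by (rule has_derivative_compose[OF _ H]) (use False inU in \<open>auto intro!: derivative_eq_intros\<close>)
    from has_derivative_scaleR[OF \<psi> this] show ?thesis
      using False by (simp add: F_def F'_def)
  qed
  have "continuous_on ({y. norm y > 1} \<union> ball 0 2) (\<lambda>y. F' y w)"
  proof (rule continuous_on_open_Un[OF op open_ball])
    show "continuous_on {y. norm y > 1} (\<lambda>y. F' y w)"
      by (rule continuous_on_eq[OF continuous_on_const[of _ 0]]) (simp add: F'_def)
    have "continuous_on (ball 0 2) (\<lambda>y. \<psi> y *\<^sub>R D (x + \<epsilon> *\<^sub>R y) (\<epsilon> *\<^sub>R w) + \<psi>' y w *\<^sub>R H (x + \<epsilon> *\<^sub>R y))"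
      by (intro continuous_intros cont\<psi> continuous_on_compose2[OF D cont_shift]
          continuous_on_compose2[OF contH cont_shift] continuous_on_subset[OF \<psi>'])
         (use inU in auto)
    then show "continuous_on (ball 0 2) (\<lambda>y. F' y w)"
      by (rule continuous_on_eq) (simp add: F'_def supp)
  qed
  moreover have "{y. norm y > 1} \<union> ball (0::'a) 2 = UNIV" by auto
  ultimately have z: "integral bump_box (\<lambda>y. F' y w) = 0"
    by (intro integral_derivative_compact_support[of F F' w] Fder) (auto simp: F_def supp)
  have F'_eq: "F' y w = \<epsilon> *\<^sub>R (\<psi> y *\<^sub>R D (x + \<epsilon> *\<^sub>R y) w) + \<psi>' y w *\<^sub>R H (x + \<epsilon> *\<^sub>R y)" for y
    by (auto simp: F'_def supp blinfun.scaleR_right)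
  have i1: "(\<lambda>y. \<psi> y *\<^sub>R D (x + \<epsilon> *\<^sub>R y) w) integrable_on bump_box"
    by (intro integrable_continuous continuous_intros cont\<psi> continuous_on_compose2[OF D cont_shift])
       (use sub in auto)
  have i2: "(\<lambda>y. \<psi>' y w *\<^sub>R H (x + \<epsilon> *\<^sub>R y)) integrable_on bump_box"
    by (intro integrable_continuous continuous_intros continuous_on_subset[OF \<psi>']
        continuous_on_compose2[OF contH cont_shift])
       (use sub in auto)
  have "integral bump_box (\<lambda>y. F' y w) = \<epsilon> *\<^sub>R integral bump_box (\<lambda>y. \<psi> y *\<^sub>R D (x + \<epsilon> *\<^sub>R y) w) +
      integral bump_box (\<lambda>y. \<psi>' y w *\<^sub>R H (x + \<epsilon> *\<^sub>R y))"
    unfolding F'_eq by (subst integral_add[OF integrable_cmul[OF i1] i2]) (rule arg_cong2[of _ _ _ _ "(+)", OF integral_cmul refl])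
  with z show ?thesis
    by (simp add: eq_neg_iff_add_eq_0 add.commute)
qed

section \<open>Clifford frames and the mean value property\<close>

lemma integral_bump_pos: "0 < integral (bump_box :: 'a::euclidean_space set) (bump 3)"
proof -
  have cont: "continuous_on bump_box (bump 3 :: 'a \<Rightarrow> real)"
    using continuous_on_bump[OF continuous_on_id] by simp
  then have int: "(bump 3 :: 'a \<Rightarrow> real) integrable_on bump_box"
    by (rule integrable_continuous)
  have "0 \<le> integral (bump_box :: 'a set) (bump 3)"
    by (rule integral_nonneg[OF int]) (simp add: bump_nonneg)
  moreover have "integral (bump_box :: 'a set) (bump 3) \<noteq> 0"
  proof
    assume "integral (bump_box :: 'a set) (bump 3) = 0"
    then have "((bump 3 :: 'a \<Rightarrow> real) has_integral 0) bump_box"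
      using integrable_integral[OF int] by simp
    moreover have "(0::'a) \<in> box (- 2 *\<^sub>R One) (2 *\<^sub>R One)"
      by (simp add: mem_box)
    then have "box (- 2 *\<^sub>R One) (2 *\<^sub>R One :: 'a) \<noteq> {}" by blast
    ultimately have "bump 3 (0::'a) = 0"
      by (intro has_integral_0_cbox_imp_0[OF cont bump_nonneg] norm_le_2_in_box) simp_all
    then show False by (simp add: bump_def)
  qed
  ultimately show ?thesis by simp
qed

lemma continuous_on_blinfun_apply_const:
  "continuous_on S D \<Longrightarrow> continuous_on S (\<lambda>x. blinfun_apply (D x) w)"
  by (intro continuous_intros)

text \<open>The mean of \<open>H\<close> around \<open>x\<close>, at distances of order \<open>\<epsilon>\<close> and with weight \<open>\<psi>\<close>. No
  normalisation is built in, because the weights include derivatives of bumps, whose integral is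
  zero.\<close>
definition average :: "('a::euclidean_space \<Rightarrow> real) \<Rightarrow> real \<Rightarrow> ('a \<Rightarrow> 'b::banach) \<Rightarrow> 'a \<Rightarrow> 'b" where
  "average \<psi> \<epsilon> H x = integral bump_box (\<lambda>y. \<psi> y *\<^sub>R H (x + \<epsilon> *\<^sub>R y))"

lemma integrable_average:
  fixes H :: "'a::euclidean_space \<Rightarrow> 'b::banach"
  assumes "continuous_on bump_box \<psi>" "continuous_on U H" "\<And>y. y \<in> bump_box \<Longrightarrow> x + \<epsilon> *\<^sub>R y \<in> U"
  shows "(\<lambda>y. \<psi> y *\<^sub>R H (x + \<epsilon> *\<^sub>R y)) integrable_on bump_box"
  by (intro integrable_continuous continuous_on_scaleR assms(1) continuous_on_compose2[OF assms(2)]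
      continuous_intros) (use assms(3) in auto)

lemma continuous_on_average:
  assumes "continuous_on bump_box \<psi>" "continuous_on U H"
    "\<And>x y. x \<in> S \<Longrightarrow> y \<in> bump_box \<Longrightarrow> x + \<epsilon> *\<^sub>R y \<in> U"
  shows "continuous_on S (average \<psi> \<epsilon> H)"
proof -
  have "continuous_on (S \<times> bump_box) (\<lambda>(x, y). \<psi> y *\<^sub>R H (x + \<epsilon> *\<^sub>R y))"
    unfolding case_prod_beta
    by (intro continuous_intros continuous_on_compose2[OF assms(1)] continuous_on_compose2[OF assms(2)])
       (use assms(3) in auto)
  then show ?thesis
    unfolding average_def[abs_def] by (rule integral_continuous_on_param)
qed

lemma average_apply:
  assumes "continuous_on bump_box \<psi>" "continuous_on U D" "\<And>y. y \<in> bump_box \<Longrightarrow> x + \<epsilon> *\<^sub>R y \<in> U"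
  shows "blinfun_apply (average \<psi> \<epsilon> D x) w = average \<psi> \<epsilon> (\<lambda>z. D z w) x"
  unfolding average_def
  by (subst blinfun_apply_integral[OF integrable_average[OF assms]]) (simp_all add: blinfun.scaleR_left)

lemma has_derivative_average:
  fixes H :: "'a::euclidean_space \<Rightarrow> 'b::banach" and D :: "'a \<Rightarrow> 'a \<Rightarrow>\<^sub>L 'b"
  assumes H: "\<And>z. z \<in> U \<Longrightarrow> (H has_derivative D z) (at z)"
    and D: "continuous_on U D" and \<psi>: "continuous_on bump_box \<psi>"
    and S: "open S" "\<And>x y. x \<in> S \<Longrightarrow> y \<in> bump_box \<Longrightarrow> x + \<epsilon> *\<^sub>R y \<in> U" and x: "x \<in> S"
  shows "(average \<psi> \<epsilon> H has_derivative average \<psi> \<epsilon> D x) (at x)"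
proof -
  obtain r where r: "r > 0" "ball x r \<subseteq> S"
    using S(1) x by (meson open_contains_ball)
  have contH: "continuous_on U H"
    using H by (meson continuous_at_imp_continuous_on has_derivative_continuous)
  have "((\<lambda>x. integral bump_box (\<lambda>y. \<psi> y *\<^sub>R H (x + \<epsilon> *\<^sub>R y))) has_derivative
      integral bump_box (\<lambda>y. \<psi> y *\<^sub>R D (x + \<epsilon> *\<^sub>R y))) (at x within ball x r)"
  proof (rule leibniz_rule)
    fix z y :: 'a assume zy: "z \<in> ball x r" "y \<in> bump_box"
    then have "z + \<epsilon> *\<^sub>R y \<in> U" using r S by blast
    then have "((\<lambda>z. H (z + \<epsilon> *\<^sub>R y)) has_derivative (\<lambda>h. D (z + \<epsilon> *\<^sub>R y) h)) (at z within ball x r)"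
      by (intro has_derivative_compose[OF _ H]) (auto intro!: derivative_eq_intros)
    from has_derivative_scaleR_right[OF this, of "\<psi> y"]
    show "((\<lambda>z. \<psi> y *\<^sub>R H (z + \<epsilon> *\<^sub>R y)) has_derivative (\<psi> y *\<^sub>R D (z + \<epsilon> *\<^sub>R y))) (at z within ball x r)"
      by (simp add: scaleR_blinfun.rep_eq)
  next
    show "(\<lambda>y. \<psi> y *\<^sub>R H (z + \<epsilon> *\<^sub>R y)) integrable_on bump_box" if "z \<in> ball x r" for z
      by (rule integrable_average[OF \<psi> contH]) (use that r S in blast)
    show "continuous_on (ball x r \<times> bump_box) (\<lambda>(x, y). \<psi> y *\<^sub>R D (x + \<epsilon> *\<^sub>R y))"
      unfolding case_prod_beta
      by (intro continuous_intros continuous_on_compose2[OF \<psi>] continuous_on_compose2[OF D])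
         (use r S in auto)
  qed (use r in auto)
  moreover have "at x within ball x r = at x"
    using r by (intro at_within_open) auto
  ultimately show ?thesis by (simp only: average_def[abs_def])
qed

text \<open>The norm comes from an inner product that need not be submultiplicative; finite dimension
  alone makes multiplication bounded.\<close>
lemma bounded_linear_mult_left_fin:
  fixes a :: "'a::{real_algebra_1,euclidean_space}"
  shows "bounded_linear (\<lambda>x. a * x)"
  by (intro linear_conv_bounded_linear[THEN iffD1] linearI) (simp_all add: distrib_left)

text \<open>The elements of \<open>B\<close> play the role of \<open>1\<close> and of anticommuting imaginary units, \<open>cj\<close> that
  of the conjugation, which fixes \<open>1\<close> and negates the units. Stating the relation through \<open>cj\<close>
  treats all elements of the frame alike.\<close>
locale clifford_frame =
  fixes B :: "'a::{real_algebra_1,euclidean_space} set" and cj :: "'a \<Rightarrow> 'a"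
  assumes finite_frame: "finite B"
    and orthonormal: "e \<in> B \<Longrightarrow> e' \<in> B \<Longrightarrow> e \<bullet> e' = (if e = e' then 1 else 0)"
    and clifford: "e \<in> B \<Longrightarrow> e' \<in> B \<Longrightarrow> cj e * e' + cj e' * e = (if e = e' then 2 else 0)"
begin

text \<open>The algebraic form of the factorisation of the Laplacian: exchanging the summation indices
  pairs \<open>cj e * e'\<close> with \<open>cj e' * e\<close>, and these two cancel off the diagonal.\<close>
lemma sum_conj_symmetric:
  fixes S :: "'a \<Rightarrow> 'a \<Rightarrow> 'a"
  assumes sym: "\<And>e e'. e \<in> B \<Longrightarrow> e' \<in> B \<Longrightarrow> S e e' = S e' e"
  shows "(\<Sum>e\<in>B. cj e * (\<Sum>e'\<in>B. e' * S e e')) = (\<Sum>e\<in>B. S e e)"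
proof -
  let ?L = "\<Sum>e\<in>B. \<Sum>e'\<in>B. cj e * e' * S e e'"
  have "?L = (\<Sum>e\<in>B. \<Sum>e'\<in>B. cj e' * e * S e e')"
    by (subst sum.swap) (auto intro!: sum.cong simp: sym)
  then have "2 *\<^sub>R ?L = (\<Sum>e\<in>B. \<Sum>e'\<in>B. (cj e * e' + cj e' * e) * S e e')"
    by (simp add: scaleR_2 distrib_right sum.distrib)
  also have "\<dots> = (\<Sum>e\<in>B. \<Sum>e'\<in>B. if e = e' then 2 * S e e' else 0)"
    by (intro sum.cong refl) (simp add: clifford)
  also have "\<dots> = (\<Sum>e\<in>B. 2 * S e e)"
    by (simp add: finite_frame sum.delta')
  also have "\<dots> = 2 *\<^sub>R (\<Sum>e\<in>B. S e e)"
    by (simp add: scaleR_2 sum.distrib mult_2)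
  finally show ?thesis by (simp add: sum_distrib_left mult.assoc)
qed

text \<open>The frame spans only part of the type. Functions on its span are represented by their
  cylindrical extensions, constant in the orthogonal directions; this is the last conjunct, and
  it allows integration over boxes and open sets of the whole type to be used for every
  dimension of the slice.\<close>
definition monogenic_deriv :: "'a set \<Rightarrow> ('a \<Rightarrow> 'a) \<Rightarrow> ('a \<Rightarrow> 'a \<Rightarrow>\<^sub>L 'a) \<Rightarrow> bool" where
  "monogenic_deriv U H D \<longleftrightarrow> open U \<and> continuous_on U D \<and>
     (\<forall>x\<in>U. (H has_derivative D x) (at x) \<and> (\<Sum>e\<in>B. e * D x e) = 0 \<and>
            (\<forall>w. D x w = (\<Sum>e\<in>B. (w \<bullet> e) *\<^sub>R D x e)))"

definition monogenic :: "'a set \<Rightarrow> ('a \<Rightarrow> 'a) \<Rightarrow> bool" where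
  "monogenic U H \<longleftrightarrow> (\<exists>D. monogenic_deriv U H D)"

text \<open>All conditions on the derivative are linear, and averaging commutes with differentiation.\<close>
lemma monogenic_deriv_average:
  assumes "monogenic_deriv U H D" "continuous_on bump_box \<psi>" "open S"
    and sub: "\<And>x y. x \<in> S \<Longrightarrow> y \<in> bump_box \<Longrightarrow> x + \<epsilon> *\<^sub>R y \<in> U"
  shows "monogenic_deriv S (average \<psi> \<epsilon> H) (average \<psi> \<epsilon> D)"
proof -
  from assms(1) have D: "continuous_on U D" and H: "\<And>x. x \<in> U \<Longrightarrow> (H has_derivative D x) (at x)"
    and dirac: "\<And>x. x \<in> U \<Longrightarrow> (\<Sum>e\<in>B. e * D x e) = 0"
    and cyl: "\<And>x w. x \<in> U \<Longrightarrow> D x w = (\<Sum>e\<in>B. (w \<bullet> e) *\<^sub>R D x e)"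
    unfolding monogenic_deriv_def by blast+
  have app: "average \<psi> \<epsilon> D x w = average \<psi> \<epsilon> (\<lambda>z. D z w) x" if "x \<in> S" for x w
    by (rule average_apply[OF assms(2) D]) (use sub that in auto)
  have int: "(\<lambda>y. \<psi> y *\<^sub>R D (x + \<epsilon> *\<^sub>R y) w) integrable_on bump_box" if "x \<in> S" for x w
    by (rule integrable_average[OF assms(2) continuous_on_blinfun_apply_const[OF D]]) (use sub that in auto)
  show ?thesis
    unfolding monogenic_deriv_def
  proof (intro conjI ballI allI)
    show "open S" by fact
    show "continuous_on S (average \<psi> \<epsilon> D)"
      by (rule continuous_on_average[OF assms(2) D sub])
    fix x assume x: "x \<in> S"
    show "(average \<psi> \<epsilon> H has_derivative average \<psi> \<epsilon> D x) (at x)"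
      by (rule has_derivative_average[OF H D assms(2,3) sub x])
    have "(\<Sum>e\<in>B. e * average \<psi> \<epsilon> D x e) = (\<Sum>e\<in>B. integral bump_box (\<lambda>y. e * (\<psi> y *\<^sub>R D (x + \<epsilon> *\<^sub>R y) e)))"
      unfolding app[OF x] unfolding average_def
      by (intro sum.cong refl integral_linear[OF int[OF x] bounded_linear_mult_left_fin, unfolded o_def, symmetric])
    also have "\<dots> = integral bump_box (\<lambda>y. \<Sum>e\<in>B. e * (\<psi> y *\<^sub>R D (x + \<epsilon> *\<^sub>R y) e))"
      by (intro integral_sum[symmetric] finite_frame
          integrable_linear[OF int[OF x] bounded_linear_mult_left_fin, unfolded o_def])
    also have "\<dots> = integral bump_box (\<lambda>y::'a. 0)"
      by (rule Henstock_Kurzweil_Integration.integral_cong) (simp add: scaleR_sum_right[symmetric] dirac[OF sub[OF x]])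
    finally show "(\<Sum>e\<in>B. e * average \<psi> \<epsilon> D x e) = 0" by simp
    fix w
    have "average \<psi> \<epsilon> D x w = integral bump_box (\<lambda>y. \<Sum>e\<in>B. (w \<bullet> e) *\<^sub>R (\<psi> y *\<^sub>R D (x + \<epsilon> *\<^sub>R y) e))"
      unfolding app[OF x] unfolding average_def
      by (rule Henstock_Kurzweil_Integration.integral_cong, subst cyl[OF sub[OF x]]) (simp_all add: scaleR_sum_right mult.commute)
    also have "\<dots> = (\<Sum>e\<in>B. (w \<bullet> e) *\<^sub>R average \<psi> \<epsilon> D x e)"
      unfolding app[OF x] unfolding average_def
      by (subst integral_sum[OF finite_frame integrable_cmul[OF int[OF x]]]) (simp only: integral_cmul)
    finally show "average \<psi> \<epsilon> D x w = (\<Sum>e\<in>B. (w \<bullet> e) *\<^sub>R average \<psi> \<epsilon> D x e)" .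
  qed
qed

text \<open>The integral is the derivative in \<open>\<epsilon>\<close> of the average of \<open>H\<close>. Since \<open>y\<close> times the bump of
  order \<open>3\<close> is a multiple of the gradient of the bump of order \<open>4\<close>, the integral is the trace of
  the matrix \<open>S e e'\<close> that pairs the \<open>e\<close>-derivative of that bump with the \<open>e'\<close>-derivative of
  \<open>H\<close>. Integration by parts makes this matrix symmetric although \<open>H\<close> has only one derivative,
  and the Cauchy-Riemann equation annihilates the sums to which \<open>sum_conj_symmetric\<close> reduces its
  trace.\<close>
lemma average_euler_deriv_zero:
  assumes mono: "monogenic_deriv U H D" and "\<epsilon> \<noteq> 0"
    and sub: "\<And>y. y \<in> bump_box \<Longrightarrow> x + \<epsilon> *\<^sub>R y \<in> U"
  shows "integral bump_box (\<lambda>y. bump 3 y *\<^sub>R D (x + \<epsilon> *\<^sub>R y) y) = 0"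
proof -
  from mono have U: "open U" and D: "continuous_on U D" and H: "\<And>x. x \<in> U \<Longrightarrow> (H has_derivative D x) (at x)"
    and dirac: "\<And>x. x \<in> U \<Longrightarrow> (\<Sum>e\<in>B. e * D x e) = 0"
    and cyl: "\<And>x w. x \<in> U \<Longrightarrow> D x w = (\<Sum>e\<in>B. (w \<bullet> e) *\<^sub>R D x e)"
    unfolding monogenic_deriv_def by blast+
  define S where "S e e' = average (dbump 4 e) \<epsilon> (\<lambda>z. D z e') x" for e e'
  have cont_db: "continuous_on A (dbump 4 e)" for A and e :: 'a
    using continuous_on_dbump[OF continuous_on_id] by simp
  have cont_ddb: "continuous_on A (ddbump 4 e w)" for A and e w :: 'a
    using continuous_on_ddbump[OF continuous_on_id] by simp
  have int: "(\<lambda>y. dbump 4 e y *\<^sub>R D (x + \<epsilon> *\<^sub>R y) w) integrable_on bump_box" for e w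
    by (rule integrable_average[OF cont_db continuous_on_blinfun_apply_const[OF D] sub])
  \<comment> \<open>The second derivatives fall on the bump, where they commute.\<close>
  have parts: "average (ddbump 4 e e') \<epsilon> H x = - \<epsilon> *\<^sub>R S e e'" for e e'
    unfolding S_def average_def
    by (rule integral_by_parts_box[OF U H D has_derivative_dbump])
       (use sub cont_ddb in \<open>auto simp: dbump_zero ddbump_zero\<close>)
  have sym: "S e e' = S e' e" for e e'
    using parts[of e e'] parts[of e' e] ddbump_commute[of 4 e e'] \<open>\<epsilon> \<noteq> 0\<close>
    by (simp add: ext[of "ddbump 4 e e'" "ddbump 4 e' e"] ddbump_commute)
  have dir: "(\<Sum>e'\<in>B. e' * S e e') = 0" for e
  proof -
    have "(\<Sum>e'\<in>B. e' * S e e') = integral bump_box (\<lambda>y. \<Sum>e'\<in>B. e' * (dbump 4 e y *\<^sub>R D (x + \<epsilon> *\<^sub>R y) e'))"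
      unfolding S_def average_def
      by (subst integral_sum[OF finite_frame integrable_linear[OF int bounded_linear_mult_left_fin, unfolded o_def]])
         (intro sum.cong refl integral_linear[OF int bounded_linear_mult_left_fin, unfolded o_def, symmetric])
    also have "\<dots> = integral bump_box (\<lambda>y::'a. 0)"
      by (rule Henstock_Kurzweil_Integration.integral_cong) (simp add: scaleR_sum_right[symmetric] dirac[OF sub])
    finally show ?thesis by simp
  qed
  have "integral bump_box (\<lambda>y. bump 3 y *\<^sub>R D (x + \<epsilon> *\<^sub>R y) y) =
      integral bump_box (\<lambda>y. \<Sum>e\<in>B. (- 1 / 8) *\<^sub>R (dbump 4 e y *\<^sub>R D (x + \<epsilon> *\<^sub>R y) e))"
    by (rule Henstock_Kurzweil_Integration.integral_cong, subst cyl[OF sub]) (simp_all add: scaleR_sum_right dbump_def mult_ac)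
  also have "\<dots> = (- 1 / 8) *\<^sub>R (\<Sum>e\<in>B. S e e)"
    unfolding S_def average_def
    by (subst integral_sum[OF finite_frame integrable_cmul[OF int]]) (simp only: integral_cmul scaleR_sum_right)
  also have "(\<Sum>e\<in>B. S e e) = (\<Sum>e\<in>B. cj e * (\<Sum>e'\<in>B. e' * S e e'))"
    by (rule sum_conj_symmetric[symmetric]) (rule sym)
  finally show ?thesis by (simp add: dir)
qed

text \<open>The average has derivative zero in the radius, and at radius zero it is a multiple of the
  value of \<open>H\<close>.\<close>
lemma mean_value_property:
  assumes mono: "monogenic_deriv U H D" and \<epsilon>: "0 \<le> \<epsilon>"
    and sub: "\<And>s y. 0 \<le> s \<Longrightarrow> s \<le> \<epsilon> \<Longrightarrow> y \<in> bump_box \<Longrightarrow> x + s *\<^sub>R y \<in> U"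
  shows "average (bump 3) \<epsilon> H x = integral (bump_box::'a set) (bump 3) *\<^sub>R H x"
proof -
  from mono have D: "continuous_on U D" and H: "\<And>x. x \<in> U \<Longrightarrow> (H has_derivative D x) (at x)"
    unfolding monogenic_deriv_def by blast+
  have contH: "continuous_on U H"
    using H by (meson continuous_at_imp_continuous_on has_derivative_continuous)
  have cont_b: "continuous_on A (bump 3)" for A :: "'a set"
    using continuous_on_bump[OF continuous_on_id] by simp
  have der: "((\<lambda>s. average (bump 3) s H x) has_vector_derivative
      integral bump_box (\<lambda>y. bump 3 y *\<^sub>R D (x + s *\<^sub>R y) y)) (at s within {0..\<epsilon>})"
    if s: "s \<in> {0..\<epsilon>}" for s
    unfolding average_def
  proof (rule leibniz_rule_vector_derivative)
    fix r :: real and y :: 'a assume ry: "r \<in> {0..\<epsilon>}" "y \<in> bump_box"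
    then have inU: "x + r *\<^sub>R y \<in> U" using sub by simp
    have "((\<lambda>r. H (x + r *\<^sub>R y)) has_derivative (\<lambda>h. D (x + r *\<^sub>R y) (h *\<^sub>R y))) (at r within {0..\<epsilon>})"
      by (rule has_derivative_compose[where f = "\<lambda>r. x + r *\<^sub>R y" and g = H])
         (auto intro!: derivative_eq_intros H[OF inU])
    from has_derivative_scaleR_right[OF this, of "bump 3 y"]
    show "((\<lambda>r. bump 3 y *\<^sub>R H (x + r *\<^sub>R y)) has_vector_derivative bump 3 y *\<^sub>R D (x + r *\<^sub>R y) y)
        (at r within {0..\<epsilon>})"
      by (simp add: has_vector_derivative_def blinfun.scaleR_right mult.commute)
  next
    show "(\<lambda>y. bump 3 y *\<^sub>R H (x + r *\<^sub>R y)) integrable_on bump_box" if "r \<in> {0..\<epsilon>}" for r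
      by (rule integrable_average[OF cont_b contH]) (use sub that in auto)
    show "continuous_on ({0..\<epsilon>} \<times> bump_box) (\<lambda>(r, y). bump 3 y *\<^sub>R D (x + r *\<^sub>R y) y)"
      unfolding case_prod_beta
      by (intro continuous_intros continuous_on_compose2[OF D]) (use sub in auto)
  qed (use s in auto)
  have "average (bump 3) \<epsilon> H x = average (bump 3) 0 H x"
  proof (rule has_derivative_zero_unique_strong_interval[of "{0}" 0 \<epsilon> "\<lambda>s. average (bump 3) s H x"])
    show "continuous_on {0..\<epsilon>} (\<lambda>s. average (bump 3) s H x)"
      using der by (meson continuous_on_eq_continuous_within has_vector_derivative_continuous)
    fix s assume s: "s \<in> {0..\<epsilon>} - {0}"
    have "integral bump_box (\<lambda>y. bump 3 y *\<^sub>R D (x + s *\<^sub>R y) y) = 0"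
      by (rule average_euler_deriv_zero[OF mono]) (use s sub in auto)
    then show "((\<lambda>s. average (bump 3) s H x) has_derivative (\<lambda>h. 0)) (at s within {0..\<epsilon>})"
      using der[of s] s by (simp add: has_vector_derivative_def)
  qed (use \<epsilon> in auto)
  also have "\<dots> = integral (bump_box::'a set) (bump 3) *\<^sub>R H x"
  proof -
    have "integral (bump_box::'a set) (\<lambda>y. bump 3 y *\<^sub>R H x) = integral (bump_box::'a set) (bump 3) *\<^sub>R H x"
      by (rule integral_linear[OF integrable_continuous[OF cont_b] bounded_linear_scaleR_left, unfolded o_def])
    then show ?thesis by (simp add: average_def)
  qed
  finally show ?thesis .
qed

end

section \<open>Interior regularity\<close>

text \<open>The value is meaningful only where \<open>H\<close> is differentiable. With this order of arguments,
  \<open>foldr dd us\<close> is the iterated derivative along the list of directions \<open>us\<close>, and \<open>dd w ^^ j\<close>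
  the derivative of order \<open>j\<close> along \<open>w\<close>.\<close>
definition dd :: "'a::real_normed_vector \<Rightarrow> ('a \<Rightarrow> 'b::real_normed_vector) \<Rightarrow> 'a \<Rightarrow> 'b" where
  "dd w H x = frechet_derivative H (at x) w"

lemma dd_eqI: "(H has_derivative D) (at x) \<Longrightarrow> dd w H x = D w"
  unfolding dd_def using frechet_derivative_at by metis

lemma dd_zero_on_open:
  assumes "open S" "x \<in> S" "\<And>y. y \<in> S \<Longrightarrow> H y = 0"
  shows "dd w H x = 0"
proof (rule dd_eqI)
  have "((\<lambda>_. 0) has_derivative (\<lambda>_. 0)) (at x)" by simp
  then show "(H has_derivative (\<lambda>_. 0)) (at x)"
    by (rule has_derivative_transform_within_open[OF _ assms(1,2)]) (use assms(3) in auto)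
qed

lemma foldr_dd_zero_on_open:
  assumes "open S" "\<And>y. y \<in> S \<Longrightarrow> H y = 0" "x \<in> S"
  shows "foldr dd us H x = 0"
  using assms(3)
proof (induction us arbitrary: x)
  case Nil
  then show ?case using assms by simp
next
  case (Cons w us)
  then show ?case using dd_zero_on_open[OF assms(1), of x "foldr dd us H"] by simp
qed

text \<open>The term of index \<open>k\<close> in the series of \<open>exp k\<close> is at most its sum.\<close>
lemma power_self_le_exp_fact: "real k ^ k \<le> exp 1 ^ k * fact k"
proof -
  have "(real k) ^ k /\<^sub>R fact k \<le> (\<Sum>j. real k ^ j /\<^sub>R fact j)"
    using sum_le_suminf[OF summable_exp_generic[of "real k"], of "{k}"] by simp
  also have "\<dots> = exp (real k)" by (simp add: exp_def)
  also have "\<dots> = exp 1 ^ k" by (simp add: exp_of_nat_mult[symmetric])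
  finally show ?thesis by (simp add: field_simps)
qed

context clifford_frame
begin

lemma monogenic_derivD:
  assumes "monogenic_deriv U H D"
  shows "open U" "continuous_on U D" "\<And>x. x \<in> U \<Longrightarrow> (H has_derivative D x) (at x)"
    "\<And>x. x \<in> U \<Longrightarrow> (\<Sum>e\<in>B. e * D x e) = 0"
    "\<And>x w. x \<in> U \<Longrightarrow> D x w = (\<Sum>e\<in>B. (w \<bullet> e) *\<^sub>R D x e)"
  using assms unfolding monogenic_deriv_def by blast+

lemma dd_eq_deriv: "monogenic_deriv U H D \<Longrightarrow> x \<in> U \<Longrightarrow> dd w H x = D x w"
  by (rule dd_eqI) (rule monogenic_derivD)

lemma monogenic_deriv_cong:
  assumes "monogenic_deriv U H D" "\<And>x. x \<in> U \<Longrightarrow> G x = H x"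
  shows "monogenic_deriv U G D"
proof -
  note D = monogenic_derivD[OF assms(1)]
  have "(G has_derivative D x) (at x)" if "x \<in> U" for x
    by (rule has_derivative_transform_within_open[OF D(3)[OF that] D(1) that]) (simp add: assms(2))
  then show ?thesis
    unfolding monogenic_deriv_def using D by blast
qed

lemma monogenic_continuous_on: "monogenic U H \<Longrightarrow> continuous_on U H"
  unfolding monogenic_def
  by (meson continuous_at_imp_continuous_on has_derivative_continuous monogenic_derivD(3))

lemma monogenic_locally:
  assumes "open U" and loc: "\<And>x. x \<in> U \<Longrightarrow> \<exists>S. open S \<and> x \<in> S \<and> monogenic S G"
  shows "monogenic U G"
proof -
  define D where "D x = Blinfun (\<lambda>w. dd w G x)" for x
  have D: "D x = E x" if "monogenic_deriv S G E" "x \<in> S" for S E x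
    using dd_eq_deriv[OF that] by (simp add: D_def blinfun_apply_inverse)
  have "monogenic_deriv U G D"
    unfolding monogenic_deriv_def
  proof (intro conjI ballI)
    show "continuous_on U D"
    proof (rule continuous_at_imp_continuous_on, rule ballI)
      fix x assume "x \<in> U"
      then obtain S E where S: "open S" "x \<in> S" "monogenic_deriv S G E"
        using loc unfolding monogenic_def by blast
      have "continuous_on S D"
        by (rule continuous_on_eq[OF monogenic_derivD(2)[OF S(3)]]) (simp add: D[OF S(3)])
      then show "isCont D x" using S by (simp add: continuous_on_eq_continuous_at)
    qed
    fix x assume "x \<in> U"
    then obtain S E where S: "x \<in> S" "monogenic_deriv S G E"
      using loc unfolding monogenic_def by blast
    show "(G has_derivative D x) (at x)" "(\<Sum>e\<in>B. e * D x e) = 0"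
      "\<forall>w. D x w = (\<Sum>e\<in>B. (w \<bullet> e) *\<^sub>R D x e)"
      using monogenic_derivD[OF S(2)] S(1) D[OF S(2,1)] by auto
  qed fact
  then show ?thesis by (auto simp: monogenic_def)
qed

text \<open>Differentiating the mean value property and moving the derivative to the bump expresses
  the derivative of \<open>H\<close> by the values of \<open>H\<close>.\<close>
lemma derivative_formula:
  assumes mono: "monogenic_deriv U H D" and \<epsilon>: "0 < \<epsilon>" and S: "open S" "x \<in> S"
    and sub: "\<And>x s y. x \<in> S \<Longrightarrow> 0 \<le> s \<Longrightarrow> s \<le> \<epsilon> \<Longrightarrow> y \<in> bump_box \<Longrightarrow> x + s *\<^sub>R y \<in> U"
  shows "average (dbump 3 w) \<epsilon> H x = - (\<epsilon> * integral (bump_box::'a set) (bump 3)) *\<^sub>R D x w"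
proof -
  note D = monogenic_derivD[OF mono]
  let ?c = "integral (bump_box::'a set) (bump 3)"
  have cont_b: "continuous_on A (bump 3)" for A :: "'a set"
    using continuous_on_bump[OF continuous_on_id] by simp
  have cont_db: "continuous_on A (dbump 3 e)" for A and e :: 'a
    using continuous_on_dbump[OF continuous_on_id] by simp
  have "0 \<in> (bump_box::'a set)" by (rule norm_le_2_in_box) simp
  then have xU: "x \<in> U" using sub[OF S(2), of 0 0] \<epsilon> by simp
  have subx: "x + \<epsilon> *\<^sub>R y \<in> U" if "x \<in> S" "y \<in> bump_box" for x y
    using sub that \<epsilon> by simp
  have "(average (bump 3) \<epsilon> H has_derivative average (bump 3) \<epsilon> D x) (at x)"
    by (rule has_derivative_average[OF D(3) D(2) cont_b S(1) subx S(2)])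
  moreover have "((\<lambda>x. ?c *\<^sub>R H x) has_derivative (\<lambda>h. ?c *\<^sub>R D x h)) (at x)"
    by (rule has_derivative_scaleR_right[OF D(3)[OF xU]])
  then have "(average (bump 3) \<epsilon> H has_derivative (\<lambda>h. ?c *\<^sub>R D x h)) (at x)"
    by (rule has_derivative_transform_within_open[OF _ S])
       (use mean_value_property[OF mono] \<epsilon> sub in simp)
  ultimately have "blinfun_apply (average (bump 3) \<epsilon> D x) = (\<lambda>h. ?c *\<^sub>R D x h)"
    by (rule has_derivative_unique)
  then have "average (bump 3) \<epsilon> (\<lambda>z. D z w) x = ?c *\<^sub>R D x w"
    using average_apply[OF cont_b D(2) subx[OF S(2)], of w] by simp
  moreover have "average (dbump 3 w) \<epsilon> H x = - \<epsilon> *\<^sub>R average (bump 3) \<epsilon> (\<lambda>z. D z w) x"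
    unfolding average_def
    by (rule integral_by_parts_box[OF D(1) D(3) D(2) has_derivative_bump])
       (use subx S cont_db in \<open>auto simp: bump_zero dbump_zero\<close>)
  ultimately show ?thesis by simp
qed

lemma box2_bounded: "\<exists>R>0. \<forall>y\<in>(bump_box::'a set). norm y \<le> R"
  using bounded_cbox bounded_pos by blast

text \<open>Near any point the derivative is an average of \<open>H\<close> against a fixed continuous weight,
  hence monogenic. In particular monogenic functions of class \<open>C\<^sup>1\<close> are smooth.\<close>
lemma monogenic_dd:
  assumes "monogenic U H"
  shows "monogenic U (dd w H)"
proof -
  obtain D where mono: "monogenic_deriv U H D" using assms by (auto simp: monogenic_def)
  note D = monogenic_derivD[OF mono]
  obtain R where R: "R > 0" "\<And>y::'a. y \<in> bump_box \<Longrightarrow> norm y \<le> R" using box2_bounded by blast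
  let ?c = "integral (bump_box::'a set) (bump 3)"
  show ?thesis
  proof (rule monogenic_locally[OF D(1)])
    fix p assume "p \<in> U"
    then obtain r' where r': "r' > 0" "ball p r' \<subseteq> U" using D(1) open_contains_ball by blast
    define r where "r = r' / 2"
    define \<epsilon> where "\<epsilon> = r / R"
    have \<epsilon>: "0 < \<epsilon>" using r' R by (simp add: \<epsilon>_def r_def)
    have sub: "x + s *\<^sub>R y \<in> U" if "x \<in> ball p r" "0 \<le> s" "s \<le> \<epsilon>" "y \<in> bump_box" for x s y
    proof -
      have "s * norm y \<le> \<epsilon> * R" using that R \<epsilon> by (intro mult_mono) auto
      then have "norm (s *\<^sub>R y) \<le> r" using that R by (simp add: \<epsilon>_def)
      then have "dist p (x + s *\<^sub>R y) < r'"
        using that(1) dist_triangle[of p "x + s *\<^sub>R y" x] by (simp add: dist_norm r_def)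
      then show ?thesis using r' by auto
    qed
    have c0: "\<epsilon> * ?c \<noteq> 0"
      using \<epsilon> integral_bump_pos[where 'a='a] by simp
    \<comment> \<open>The weight that turns the formula for the derivative of \<open>H\<close> into an average.\<close>
    define \<psi> :: "'a \<Rightarrow> real" where "\<psi> y = - inverse (\<epsilon> * ?c) * dbump 3 w y" for y
    have \<psi>: "continuous_on bump_box \<psi>"
      unfolding \<psi>_def[abs_def] by (intro continuous_intros)
    have avg: "average \<psi> \<epsilon> H x = - inverse (\<epsilon> * ?c) *\<^sub>R average (dbump 3 w) \<epsilon> H x" for x
      unfolding average_def \<psi>_def by (simp only: scaleR_scaleR[symmetric] integral_cmul)
    have "monogenic_deriv (ball p r) (average \<psi> \<epsilon> H) (average \<psi> \<epsilon> D)"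
      by (rule monogenic_deriv_average[OF mono \<psi>]) (use sub \<epsilon> in auto)
    moreover have "dd w H x = average \<psi> \<epsilon> H x" if x: "x \<in> ball p r" for x
    proof -
      have "x \<in> U" using sub[OF x, of 0 0] \<epsilon> norm_le_2_in_box[of 0] by simp
      moreover have "average (dbump 3 w) \<epsilon> H x = - (\<epsilon> * ?c) *\<^sub>R D x w"
        by (rule derivative_formula[OF mono \<epsilon> open_ball x sub])
      ultimately show ?thesis
        using c0 by (simp add: avg dd_eq_deriv[OF mono] del: inverse_mult_distrib)
    qed
    ultimately have "monogenic (ball p r) (dd w H)"
      unfolding monogenic_def using monogenic_deriv_cong by blast
    then show "\<exists>S. open S \<and> p \<in> S \<and> monogenic S (dd w H)"
      using r' by (intro exI[of _ "ball p r"]) (simp add: r_def)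
  qed
qed

lemma monogenic_foldr_dd: "monogenic U H \<Longrightarrow> monogenic U (foldr dd us H)"
  by (induction us) (auto intro: monogenic_dd)

lemma monogenic_funpow_dd: "monogenic U H \<Longrightarrow> monogenic U ((dd w ^^ j) H)"
  by (induction j) (auto intro: monogenic_dd)

text \<open>The radius in the derivative formula is chosen proportional to \<open>r\<close>, with a factor that
  depends on the type only.\<close>
lemma gradient_estimate:
  obtains C where "C > 0"
    "\<And>U H x r M w. \<lbrakk>monogenic U H; 0 < r; cball x r \<subseteq> U; \<And>z. z \<in> cball x r \<Longrightarrow> norm (H z) \<le> M\<rbrakk>
       \<Longrightarrow> norm (dd w H x) \<le> C * norm w / r * M"
proof -
  obtain R where R: "R > 0" "\<And>y::'a. y \<in> bump_box \<Longrightarrow> norm y \<le> R" using box2_bounded by blast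
  let ?c = "integral (bump_box::'a set) (bump 3)" and ?V = "measure lborel (bump_box :: 'a set)"
  have c: "?c > 0" by (rule integral_bump_pos)
  define C where "C = (R / ?c) * 6 * (?V + 1)"
  have V: "0 \<le> ?V" by (rule measure_nonneg)
  have "C > 0"
    unfolding C_def by (intro mult_pos_pos divide_pos_pos) (use c R V in auto)
  moreover have "norm (dd w H x) \<le> C * norm w / r * M"
    if hm: "monogenic U H" and r: "0 < r" and cb: "cball x r \<subseteq> U"
      and M: "\<And>z. z \<in> cball x r \<Longrightarrow> norm (H z) \<le> M" for U H x r M w
  proof -
    obtain D where mono: "monogenic_deriv U H D" using hm unfolding monogenic_def by blast
    note D = monogenic_derivD[OF mono]
    define \<epsilon> where "\<epsilon> = r / R"
    have \<epsilon>: "0 < \<epsilon>" using r R by (simp add: \<epsilon>_def)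
    have M0: "0 \<le> M" using M[of x] r norm_ge_zero[of "H x"] by (simp del: norm_ge_zero)
    obtain r' where r': "r' > 0" "\<And>z z'. z \<in> cball x r \<Longrightarrow> dist z z' < r' \<Longrightarrow> z' \<in> U"
      using compact_subset_open_imp_ball_epsilon_subset[OF compact_cball D(1) cb]
      by (metis UN_iff mem_ball subsetD)
    have small: "norm (s *\<^sub>R y) \<le> r" if "0 \<le> s" "s \<le> \<epsilon>" "y \<in> bump_box" for s and y :: 'a
    proof -
      have "s * norm y \<le> \<epsilon> * R" using that R \<epsilon> by (intro mult_mono) auto
      then show ?thesis using that R by (simp add: \<epsilon>_def)
    qed
    have sub: "z + s *\<^sub>R y \<in> U" if "z \<in> ball x r'" "0 \<le> s" "s \<le> \<epsilon>" "y \<in> bump_box" for z s y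
      by (rule r'(2)[of "x + s *\<^sub>R y"]) (use small that in \<open>auto simp: dist_norm\<close>)
    have formula: "average (dbump 3 w) \<epsilon> H x = - (\<epsilon> * ?c) *\<^sub>R D x w"
      by (rule derivative_formula[OF mono \<epsilon> open_ball _ sub]) (use r' in auto)
    have "continuous_on bump_box (dbump 3 w :: 'a \<Rightarrow> real)"
      using continuous_on_dbump[OF continuous_on_id] by simp
    then have "(\<lambda>y. dbump 3 w y *\<^sub>R H (x + \<epsilon> *\<^sub>R y)) integrable_on bump_box"
      by (rule integrable_average[OF _ monogenic_continuous_on[OF hm]]) (use sub r' \<epsilon> in auto)
    then have "norm (average (dbump 3 w) \<epsilon> H x) \<le> (6 * norm w * M) * ?V"
      unfolding average_def
    proof (intro has_integral_bound[OF _ integrable_integral])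
      fix y :: 'a assume y: "y \<in> bump_box"
      have "x + \<epsilon> *\<^sub>R y \<in> cball x r" using small[of \<epsilon> y] y \<epsilon> by (simp add: dist_norm)
      then show "norm (dbump 3 w y *\<^sub>R H (x + \<epsilon> *\<^sub>R y)) \<le> 6 * norm w * M"
        using norm_dbump_le[of 3 w y] M by (auto intro!: mult_mono)
    qed (use M0 in auto)
    \<comment> \<open>Increasing the volume by one makes \<open>C\<close> visibly positive.\<close>
    also have "\<dots> \<le> (6 * norm w * M) * (?V + 1)"
      using M0 by (intro mult_left_mono) auto
    finally have "(\<epsilon> * ?c) * norm (D x w) \<le> 6 * norm w * M * (?V + 1)"
      unfolding formula using \<epsilon> c by (simp add: abs_mult)
    then have "norm (D x w) \<le> 6 * norm w * M * (?V + 1) / (\<epsilon> * ?c)"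
      using \<epsilon> c by (simp add: field_simps)
    also have "\<dots> = C * norm w / r * M"
      using R r c by (simp add: C_def \<epsilon>_def field_simps)
    finally have "norm (D x w) \<le> C * norm w / r * M" .
    moreover have "x \<in> U" using cb r by auto
    ultimately show ?thesis by (simp only: dd_eq_deriv[OF mono])
  qed
  ultimately show thesis using that by blast
qed

text \<open>Induction on \<open>k\<close>: the bound for the derivative along \<open>w\<close> integrates to the bound for \<open>H\<close>.\<close>
lemma taylor_bound:
  assumes "monogenic U H" and seg: "\<And>s. s \<in> {0..a} \<Longrightarrow> p + s *\<^sub>R w \<in> U"
    and "\<And>j. j < k \<Longrightarrow> (dd w ^^ j) H p = 0"
    and "\<And>s. s \<in> {0..a} \<Longrightarrow> norm ((dd w ^^ k) H (p + s *\<^sub>R w)) \<le> K"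
    and "s \<in> {0..a}"
  shows "norm (H (p + s *\<^sub>R w)) \<le> K * s ^ k / fact k"
  using assms(1,3-)
proof (induction k arbitrary: H s)
  case 0
  then show ?case by simp
next
  case (Suc k)
  obtain D where mono: "monogenic_deriv U H D" using Suc.prems by (auto simp: monogenic_def)
  note D = monogenic_derivD[OF mono]
  have IH: "norm (dd w H (p + s *\<^sub>R w)) \<le> K * s ^ k / fact k" if "s \<in> {0..a}" for s
  proof (rule Suc.IH[OF monogenic_dd[OF Suc.prems(1)] _ _ that])
    show "(dd w ^^ j) (dd w H) p = 0" if "j < k" for j
      using Suc.prems(2)[of "Suc j"] that by (simp add: funpow_swap1)
    show "norm ((dd w ^^ k) (dd w H) (p + s *\<^sub>R w)) \<le> K" if "s \<in> {0..a}" for s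
      using Suc.prems(3)[OF that] by (simp add: funpow_swap1)
  qed
  have H0: "H p = 0" using Suc.prems(2)[of 0] by simp
  show ?case
  proof (cases "s = 0")
    case True
    then show ?thesis using H0 by simp
  next
    case False
    then have s: "0 < s" "s \<le> a" using Suc.prems(4) by auto
    have der: "((\<lambda>s. H (p + s *\<^sub>R w)) has_vector_derivative dd w H (p + r *\<^sub>R w)) (at r)"
      if "r \<in> {0..a}" for r
    proof -
      have "((\<lambda>s. H (p + s *\<^sub>R w)) has_derivative (\<lambda>h. D (p + r *\<^sub>R w) (h *\<^sub>R w))) (at r)"
        by (rule has_derivative_compose[where f = "\<lambda>s. p + s *\<^sub>R w" and g = H])
           (auto intro!: derivative_eq_intros D(3) seg that)
      then show ?thesis
        by (simp add: has_vector_derivative_def blinfun.scaleR_right dd_eq_deriv[OF mono seg[OF that]])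
    qed
    have "norm (H (p + s *\<^sub>R w) - H (p + 0 *\<^sub>R w)) \<le> K * s ^ Suc k / fact (Suc k) - K * 0 ^ Suc k / fact (Suc k)"
    proof (rule differentiable_bound_general[OF s(1), of "\<lambda>s. H (p + s *\<^sub>R w)"
          "\<lambda>s. K * s ^ Suc k / fact (Suc k)" "\<lambda>r. dd w H (p + r *\<^sub>R w)" "\<lambda>s. K * s ^ k / fact k"])
      show "continuous_on {0..s} (\<lambda>s. H (p + s *\<^sub>R w))"
        using s by (intro continuous_at_imp_continuous_on ballI has_vector_derivative_continuous[OF der]) auto
      show "continuous_on {0..s} (\<lambda>s. K * s ^ Suc k / fact (Suc k))"
        by (intro continuous_intros) auto
      fix r assume r: "0 < r" "r < s"
      then show "((\<lambda>s. H (p + s *\<^sub>R w)) has_vector_derivative dd w H (p + r *\<^sub>R w)) (at r)"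
        "norm (dd w H (p + r *\<^sub>R w)) \<le> K * r ^ k / fact k"
        using der[of r] IH[of r] s by auto
      have "((\<lambda>s. K * s ^ Suc k / fact (Suc k)) has_real_derivative
          K * (real (Suc k) * r ^ k) / fact (Suc k)) (at r)"
        by (intro derivative_eq_intros refl) auto
      moreover have "K * (real (Suc k) * r ^ k) / fact (Suc k) = K * r ^ k / fact k"
        by (simp add: fact_Suc del: of_nat_Suc)
      ultimately show "((\<lambda>s. K * s ^ Suc k / fact (Suc k)) has_vector_derivative K * r ^ k / fact k) (at r)"
        by (simp add: has_real_derivative_iff_has_vector_derivative[symmetric])
    qed
    then show ?thesis using H0 by simp
  qed
qed

text \<open>Analyticity in quantitative form. Applying the gradient estimate \<open>k\<close> times with radius
  \<open>R / 2k\<close> bounds the derivatives of order \<open>k\<close> on the half ball by a multiple of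
  \<open>(2 k C / R)\<^sup>k\<close>. Against the factor \<open>1 / k!\<close> of the Taylor remainder this decays geometrically
  for directions that are short compared with \<open>R / C\<close>.\<close>
lemma zero_near_flat_point:
  assumes mono: "monogenic U H" and p: "p \<in> U" and flat: "\<And>w j. (dd w ^^ j) H p = 0"
  shows "\<exists>r>0. ball p r \<subseteq> U \<and> (\<forall>x\<in>ball p r. H x = 0)"
proof -
  obtain C where C: "C > 0"
    and est: "\<And>U H x r M w. \<lbrakk>monogenic U H; 0 < r; cball x r \<subseteq> U; \<And>z. z \<in> cball x r \<Longrightarrow> norm (H z) \<le> M\<rbrakk>
       \<Longrightarrow> norm (dd w H x) \<le> C * norm w / r * M"
    using gradient_estimate by metis
  have "open U" using mono by (auto simp: monogenic_def monogenic_deriv_def)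
  then obtain R where R: "R > 0" "cball p R \<subseteq> U" using p open_contains_cball by blast
  have "bounded (H ` cball p R)"
    by (intro compact_imp_bounded compact_continuous_image compact_cball
        continuous_on_subset[OF monogenic_continuous_on[OF mono] R(2)])
  then obtain M where "\<forall>y\<in>H ` cball p R. norm y \<le> M"
    unfolding bounded_iff by blast
  then have M: "norm (H z) \<le> M" if "z \<in> cball p R" for z
    using that by blast
  have M0: "0 \<le> M" using M[of p] R norm_ge_zero[of "H p"] by (simp del: norm_ge_zero)
  have iter: "norm ((dd w ^^ j) H x) \<le> (C * norm w * (2 * real k) / R) ^ j * M"
    if k: "0 < k" and "j \<le> k" "x \<in> cball p (R - real j * (R / (2 * real k)))" for j k w x
    using that(2-)
  proof (induction j arbitrary: x)
    case 0
    then show ?case using M by simp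
  next
    case (Suc j)
    let ?r = "R / (2 * real k)"
    have r: "0 < ?r" using R k by simp
    have sub: "cball x ?r \<subseteq> cball p (R - real j * ?r)"
    proof
      fix z assume z: "z \<in> cball x ?r"
      have "dist p z \<le> dist p x + dist x z" by (rule dist_triangle)
      then have "dist p z \<le> R - real (Suc j) * ?r + ?r" using z Suc.prems by simp
      then show "z \<in> cball p (R - real j * ?r)" by (simp add: algebra_simps add_divide_distrib)
    qed
    have "cball p (R - real j * ?r) \<subseteq> cball p R"
      using mult_nonneg_nonneg[of "real j" ?r] r by (intro subset_cball) linarith
    then have "norm (dd w ((dd w ^^ j) H) x) \<le> C * norm w / ?r * ((C * norm w * (2 * real k) / R) ^ j * M)"
      using sub R Suc by (intro est[OF monogenic_funpow_dd[OF mono] r]) auto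
    then show ?case by (simp add: mult_ac)
  qed
  \<comment> \<open>Below this radius the ratio of the geometric bound is at most \<open>1 / 2\<close>.\<close>
  define \<rho> where "\<rho> = min (R / 2) (R / (4 * exp 1 * C))"
  have \<rho>: "\<rho> > 0" using R C by (simp add: \<rho>_def)
  have "H x = 0" if x: "x \<in> ball p \<rho>" for x
  proof -
    define w where "w = x - p"
    have w: "norm w < R / 2" "norm w \<le> R / (4 * exp 1 * C)"
      using x by (auto simp: w_def \<rho>_def dist_norm norm_minus_commute)
    have seg: "p + s *\<^sub>R w \<in> cball p (R / 2)" if "s \<in> {0..1}" for s
    proof -
      have "\<bar>s\<bar> * norm w \<le> 1 * norm w" using that by (intro mult_right_mono) auto
      then show ?thesis using w by (simp add: dist_norm)
    qed
    have bound: "norm (H x) \<le> (1 / 2) ^ k * M" if k: "0 < k" for k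
    proof -
      define K where "K = (C * norm w * (2 * real k) / R) ^ k * M"
      have "norm (H (p + 1 *\<^sub>R w)) \<le> K * 1 ^ k / fact k"
      proof (rule taylor_bound[OF mono, of 1])
        fix s :: real assume s: "s \<in> {0..1}"
        show "p + s *\<^sub>R w \<in> U" using seg[OF s] R by auto
        have "R - real k * (R / (2 * real k)) = R / 2" using k by simp
        then show "norm ((dd w ^^ k) H (p + s *\<^sub>R w)) \<le> K"
          unfolding K_def using seg[OF s] by (intro iter[OF k]) auto
      qed (use flat in auto)
      also have "\<dots> = (2 * C * norm w / R) ^ k * M * (real k ^ k / fact k)"
        by (simp add: K_def power_mult_distrib power_divide field_simps)
      also have "\<dots> \<le> (2 * C * norm w / R) ^ k * M * exp 1 ^ k"
        using power_self_le_exp_fact[of k] C R M0 by (intro mult_left_mono) (auto simp: field_simps)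
      also have "\<dots> = (2 * C * norm w / R * exp 1) ^ k * M"
        unfolding power_mult_distrib[of "2 * C * norm w / R" "exp 1" k] by (simp only: mult_ac)
      also have "\<dots> \<le> (1 / 2) ^ k * M"
        using w(2) C R M0 by (intro mult_right_mono power_mono) (auto simp: field_simps)
      finally show ?thesis by (simp add: w_def)
    qed
    have "(\<lambda>k. (1 / 2) ^ k * M) \<longlonglongrightarrow> 0 * M"
      by (intro tendsto_intros) auto
    then have "norm (H x) \<le> 0 * M"
      by (rule LIMSEQ_le_const) (use bound in \<open>auto intro!: exI[of _ 1]\<close>)
    then show ?thesis by simp
  qed
  moreover have "ball p \<rho> \<subseteq> U"
    using R(2) by (rule order_trans[rotated]) (use R(1) in \<open>auto simp: \<rho>_def\<close>)
  ultimately show ?thesis using \<rho> by blast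
qed

end

section \<open>Unique continuation\<close>

context clifford_frame
begin

lemma foldr_dd_linear:
  assumes "monogenic U G" "\<And>e. e \<in> B \<Longrightarrow> monogenic U (F e)"
    and "\<And>x. x \<in> U \<Longrightarrow> G x = (\<Sum>e\<in>B. a e *\<^sub>R F e x)" and "x \<in> U"
  shows "foldr dd us G x = (\<Sum>e\<in>B. a e *\<^sub>R foldr dd us (F e) x)"
  using \<open>x \<in> U\<close>
proof (induction us arbitrary: x)
  case Nil
  then show ?case using assms by simp
next
  case (Cons w us)
  have U: "open U" using assms(1) by (auto simp: monogenic_def monogenic_deriv_def)
  have "\<exists>D. (foldr dd us (F e) has_derivative D) (at x)" if "e \<in> B" for e
    using monogenic_foldr_dd[OF assms(2)[OF that]] Cons.prems
    unfolding monogenic_def monogenic_deriv_def by blast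
  then obtain D where D: "\<And>e. e \<in> B \<Longrightarrow> (foldr dd us (F e) has_derivative D e) (at x)" by metis
  have "((\<lambda>x. \<Sum>e\<in>B. a e *\<^sub>R foldr dd us (F e) x) has_derivative (\<lambda>h. \<Sum>e\<in>B. a e *\<^sub>R D e h)) (at x)"
    using D by (intro has_derivative_sum has_derivative_scaleR_right) auto
  then have "(foldr dd us G has_derivative (\<lambda>h. \<Sum>e\<in>B. a e *\<^sub>R D e h)) (at x)"
    by (rule has_derivative_transform_within_open[OF _ U Cons.prems]) (simp add: Cons.IH)
  from dd_eqI[OF this] show ?case using dd_eqI[OF D] by simp
qed

text \<open>Directions are restricted to the frame in order to have countably many iterated
  derivatives.\<close>
definition flat :: "('a \<Rightarrow> 'a) \<Rightarrow> 'a \<Rightarrow> bool" where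
  "flat H x \<longleftrightarrow> (\<forall>us\<in>lists B. foldr dd us H x = 0)"

text \<open>The derivative in an arbitrary direction is a combination of the derivatives along the
  frame.\<close>
lemma flat_dd:
  assumes "monogenic U H" "x \<in> U" "flat H x"
  shows "flat (dd w H) x"
  unfolding flat_def
proof
  fix us assume us: "us \<in> lists B"
  obtain D where mono: "monogenic_deriv U H D" using assms by (auto simp: monogenic_def)
  have "foldr dd us (dd w H) x = (\<Sum>e\<in>B. (w \<bullet> e) *\<^sub>R foldr dd us (dd e H) x)"
  proof (rule foldr_dd_linear[OF monogenic_dd[OF assms(1)] monogenic_dd[OF assms(1)] _ assms(2)])
    fix y assume y: "y \<in> U"
    show "dd w H y = (\<Sum>e\<in>B. (w \<bullet> e) *\<^sub>R dd e H y)"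
      unfolding dd_eq_deriv[OF mono y] by (rule monogenic_derivD(5)[OF mono y])
  qed
  also have "\<dots> = 0"
  proof (intro sum.neutral ballI)
    fix e assume "e \<in> B"
    then have "us @ [e] \<in> lists B" using us by simp
    then have "foldr dd (us @ [e]) H x = 0" using assms(3) unfolding flat_def by blast
    then show "(w \<bullet> e) *\<^sub>R foldr dd us (dd e H) x = 0" by simp
  qed
  finally show "foldr dd us (dd w H) x = 0" .
qed

text \<open>The set of flat points is closed by continuity, and open because the function vanishes
  near a flat point.\<close>
theorem flat_identity:
  assumes mono: "monogenic U H" and X: "connected X" "X \<subseteq> U" and p: "p \<in> X" "flat H p"
    and x: "x \<in> X"
  shows "H x = 0"
proof -
  define S where "S = {x \<in> X. flat H x}"
  have "openin (top_of_set X) S"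
    unfolding openin_contains_ball
  proof (intro conjI ballI)
    show "S \<subseteq> X" by (auto simp: S_def)
    fix x assume x: "x \<in> S"
    then have xU: "x \<in> U" "flat H x" using X by (auto simp: S_def)
    have "flat ((dd w ^^ j) H) x" for w j
      by (induction j) (use xU mono in \<open>auto intro: flat_dd monogenic_funpow_dd\<close>)
    then have "(dd w ^^ j) H x = 0" for w j
      unfolding flat_def by (metis foldr.simps(1) id_apply lists.Nil)
    then obtain r where r: "r > 0" "ball x r \<subseteq> U" "\<forall>y\<in>ball x r. H y = 0"
      using zero_near_flat_point[OF mono xU(1)] by blast
    then have "flat H y" if "y \<in> ball x r" for y
      unfolding flat_def using foldr_dd_zero_on_open[OF open_ball] that by blast
    then show "\<exists>e>0. ball x e \<inter> X \<subseteq> S" using r by (auto simp: S_def)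
  qed
  moreover have "closedin (top_of_set X) S"
  proof -
    have "closedin (top_of_set X) {x \<in> X. foldr dd us H x = 0}" for us
      by (intro continuous_closedin_preimage_constant
          continuous_on_subset[OF monogenic_continuous_on[OF monogenic_foldr_dd[OF mono]] X(2)])
    then have "closedin (top_of_set X) (\<Inter>us\<in>lists B. {x \<in> X. foldr dd us H x = 0})"
      by (intro closedin_INT) auto
    moreover have "(\<Inter>us\<in>lists B. {x \<in> X. foldr dd us H x = 0}) = S"
      by (auto simp: S_def flat_def)
    ultimately show ?thesis by simp
  qed
  ultimately have "S = {} \<or> S = X" using X(1) connected_clopen by blast
  then have "flat H x" using p x by (auto simp: S_def)
  then have "foldr dd [] H x = 0" unfolding flat_def by (metis lists.Nil)
  then show ?thesis by simp
qed

end

section \<open>Sets of Hausdorff measure zero\<close>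

lemma hausdorff_measure_eq_0_iff:
  "hausdorff_measure s E = 0 \<longleftrightarrow> (\<forall>\<delta>>0. hausdorff_premeasure s \<delta> E = 0)"
  unfolding hausdorff_measure_def bot_ennreal[symmetric] by (auto simp: SUP_bot_conv)

lemma hausdorff_null_subset:
  assumes "hausdorff_measure s F = 0" "E \<subseteq> F"
  shows "hausdorff_measure s E = 0"
proof -
  have "hausdorff_premeasure s \<delta> E \<le> hausdorff_premeasure s \<delta> F" for \<delta>
    unfolding hausdorff_premeasure_def by (rule INF_superset_mono) (use assms(2) in auto)
  then show ?thesis
    using assms(1) unfolding hausdorff_measure_eq_0_iff by (metis le_zero_eq)
qed

text \<open>Cover the set of index \<open>i\<close> with total weight below \<open>\<epsilon> / 2\<^sup>i\<^sup>+\<^sup>1\<close> and enumerate the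
  resulting double sequence of covering sets.\<close>
lemma hausdorff_null_UN_nat:
  fixes E :: "nat \<Rightarrow> 'a::metric_space set"
  assumes null: "\<And>i. hausdorff_measure s (E i) = 0"
  shows "hausdorff_measure s (\<Union>i. E i) = 0"
  unfolding hausdorff_measure_eq_0_iff
proof (intro allI impI)
  fix \<delta> :: real assume \<delta>: "\<delta> > 0"
  have "hausdorff_premeasure s \<delta> (\<Union>i. E i) \<le> 0 + ennreal \<epsilon>" if \<epsilon>: "\<epsilon> > 0" for \<epsilon> :: real
  proof -
    have "\<exists>U. E i \<subseteq> (\<Union>j. U j) \<and> (\<forall>j. bounded (U j) \<and> diameter (U j) \<le> \<delta>) \<and>
        (\<Sum>j. hausdorff_weight s (U j)) < ennreal (\<epsilon> * (1/2) ^ Suc i)" for i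
    proof -
      have "hausdorff_premeasure s \<delta> (E i) < ennreal (\<epsilon> * (1/2) ^ Suc i)"
        using null[of i] \<delta> \<epsilon> unfolding hausdorff_measure_eq_0_iff by simp
      then show ?thesis unfolding hausdorff_premeasure_def INF_less_iff by blast
    qed
    then obtain U where U: "\<And>i. E i \<subseteq> (\<Union>j. U i j)"
      "\<And>i j. bounded (U i j) \<and> diameter (U i j) \<le> \<delta>"
      "\<And>i. (\<Sum>j. hausdorff_weight s (U i j)) < ennreal (\<epsilon> * (1/2) ^ Suc i)"
      by metis
    define W where "W k = (case prod_decode k of (i, j) \<Rightarrow> U i j)" for k
    have "x \<in> (\<Union>k. W k)" if x: "x \<in> E i" for x i
    proof -
      obtain j where "x \<in> U i j" using U(1) x by blast
      then have "x \<in> W (prod_encode (i, j))" by (simp add: W_def)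
      then show ?thesis by blast
    qed
    then have "hausdorff_premeasure s \<delta> (\<Union>i. E i) \<le> (\<Sum>k. hausdorff_weight s (W k))"
      unfolding hausdorff_premeasure_def
      by (intro INF_lower) (auto simp: W_def U(2) split: prod.splits)
    also have "\<dots> = (\<Sum>k. (\<lambda>(i, j). hausdorff_weight s (U i j)) (prod_decode k))"
      by (intro suminf_cong) (simp add: W_def split: prod.splits)
    also have "\<dots> = (\<Sum>i. \<Sum>j. hausdorff_weight s (U i j))"
      by (rule suminf_ennreal_2dimen) simp
    also have "\<dots> \<le> (\<Sum>i. ennreal (\<epsilon> * (1/2) ^ Suc i))"
      by (intro suminf_le less_imp_le U(3)) auto
    also have "\<dots> = ennreal (\<epsilon> * 1)"
      by (rule suminf_ennreal_eq[OF _ sums_mult[OF power_half_series]]) (use \<epsilon> in auto)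
    finally show ?thesis by simp
  qed
  then have "hausdorff_premeasure s \<delta> (\<Union>i. E i) \<le> 0"
    by (rule ennreal_le_epsilon)
  then show "hausdorff_premeasure s \<delta> (\<Union>i. E i) = 0" by simp
qed

lemma hausdorff_null_empty: "hausdorff_measure s ({} :: 'a::metric_space set) = 0"
  unfolding hausdorff_measure_eq_0_iff
proof (intro allI impI)
  fix \<delta> :: real assume "\<delta> > 0"
  then have "hausdorff_premeasure s \<delta> ({}::'a set) \<le> (\<Sum>i::nat. hausdorff_weight s ({}::'a set))"
    unfolding hausdorff_premeasure_def by (intro INF_lower) (auto simp: diameter_def)
  then show "hausdorff_premeasure s \<delta> ({}::'a set) = 0"
    by (simp add: hausdorff_weight_def)
qed

lemma hausdorff_null_UN:
  assumes "countable I" "\<And>i. i \<in> I \<Longrightarrow> hausdorff_measure s (E i) = 0"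
  shows "hausdorff_measure s (\<Union>i\<in>I. E i) = 0"
proof (cases "I = {}")
  case True
  then show ?thesis by (simp add: hausdorff_null_empty)
next
  case False
  have "hausdorff_measure s (\<Union>n. E (from_nat_into I n)) = 0"
    by (intro hausdorff_null_UN_nat assms(2) from_nat_into False)
  moreover have "(\<Union>n. E (from_nat_into I n)) = \<Union> (E ` range (from_nat_into I))"
    by (simp only: image_image)
  ultimately show ?thesis by (simp only: range_from_nat_into[OF False assms(1)])
qed

text \<open>With \<open>A N\<^sup>q\<close> sets of diameter at most \<open>C / N\<close>, the total weight is of order \<open>N\<close> to the
  power \<open>q - s\<close>, which tends to \<open>0\<close>.\<close>
lemma hausdorff_null_if_box_count:
  fixes E :: "'a::metric_space set" and A C s :: real
  assumes C: "C > 0" and A: "A \<ge> 0" and s: "s > real q"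
    and cover: "\<And>N::nat. N \<ge> 1 \<Longrightarrow> \<exists>F. finite F \<and> real (card F) \<le> A * real N ^ q \<and> E \<subseteq> \<Union>F \<and>
         (\<forall>U\<in>F. bounded U \<and> diameter U \<le> C / real N)"
  shows "hausdorff_measure s E = 0"
  unfolding hausdorff_measure_eq_0_iff
proof (intro allI impI)
  fix \<delta> :: real assume \<delta>: "\<delta> > 0"
  have s0: "s > 0" using s by (meson of_nat_0_le_iff order_le_less_trans)
  have "hausdorff_premeasure s \<delta> E \<le> 0 + ennreal \<epsilon>" if \<epsilon>: "\<epsilon> > 0" for \<epsilon> :: real
  proof -
    have "((\<lambda>N. C / real N) \<longlongrightarrow> 0) sequentially" by (rule lim_const_over_n)
    then have "eventually (\<lambda>N. C / real N < \<delta>) sequentially"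
      using \<delta> by (rule order_tendstoD)
    moreover have "((\<lambda>N. A * C powr s * real N powr (real q - s)) \<longlongrightarrow> A * C powr s * 0) sequentially"
      by (intro tendsto_intros tendsto_neg_powr filterlim_real_sequentially) (use s in auto)
    then have "eventually (\<lambda>N. A * C powr s * real N powr (real q - s) < \<epsilon>) sequentially"
      using \<epsilon> by (intro order_tendstoD(2)) auto
    moreover have "eventually (\<lambda>N::nat. N \<ge> 1) sequentially" by (rule eventually_ge_at_top)
    ultimately have "eventually (\<lambda>N. C / real N < \<delta> \<and> A * C powr s * real N powr (real q - s) < \<epsilon> \<and> N \<ge> 1) sequentially"
      by eventually_elim simp
    then obtain N where N: "C / real N < \<delta>" "A * C powr s * real N powr (real q - s) < \<epsilon>" "N \<ge> 1"
      using eventually_happens'[OF sequentially_bot] by blast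
    obtain F where F: "finite F" "real (card F) \<le> A * real N ^ q" "E \<subseteq> \<Union>F"
      "\<And>U. U \<in> F \<Longrightarrow> bounded U \<and> diameter U \<le> C / real N"
      using cover[OF N(3)] by metis
    obtain h where h: "bij_betw h {0..<card F} F"
      using ex_bij_betw_nat_finite[OF F(1)] by blast
    define U where "U i = (if i < card F then h i else {})" for i
    have hF: "h i \<in> F" if "i < card F" for i using h that by (auto simp: bij_betw_def)
    have weight: "hausdorff_weight s (U i) \<le> ennreal ((C / real N) powr s)" for i
    proof (cases "i < card F")
      case True
      have "diameter (h i) powr s \<le> (C / real N) powr s"
        using F(4)[OF hF[OF True]] s0 by (intro powr_mono2 diameter_ge_0) auto
      then show ?thesis using True s0 by (auto simp: hausdorff_weight_def U_def ennreal_leI)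
    qed (simp add: hausdorff_weight_def U_def)
    have "E \<subseteq> (\<Union>i. U i)"
    proof
      fix x assume "x \<in> E"
      then obtain Y where "Y \<in> F" "x \<in> Y" using F(3) by blast
      then have "Y \<in> h ` {0..<card F}" using h by (simp add: bij_betw_def)
      then obtain i where "i < card F" "x \<in> h i" using \<open>x \<in> Y\<close> by auto
      then have "x \<in> U i" by (simp add: U_def)
      then show "x \<in> (\<Union>i. U i)" by blast
    qed
    moreover have "bounded (U i) \<and> diameter (U i) \<le> \<delta>" for i
      using F(4)[OF hF, of i] N(1) \<delta> by (auto simp: U_def)
    ultimately have "hausdorff_premeasure s \<delta> E \<le> (\<Sum>i. hausdorff_weight s (U i))"
      unfolding hausdorff_premeasure_def by (intro INF_lower) auto
    also have "\<dots> = (\<Sum>i<card F. hausdorff_weight s (U i))"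
      by (rule suminf_finite) (auto simp: U_def hausdorff_weight_def)
    also have "\<dots> \<le> (\<Sum>i<card F. ennreal ((C / real N) powr s))"
      by (intro sum_mono weight)
    also have "\<dots> = ennreal (real (card F) * (C / real N) powr s)"
      by (simp add: ennreal_mult ennreal_of_nat_eq_real_of_nat)
    also have "\<dots> \<le> ennreal (A * real N ^ q * (C / real N) powr s)"
      by (intro ennreal_leI mult_right_mono F(2)) auto
    also have "A * real N ^ q * (C / real N) powr s = A * C powr s * real N powr (real q - s)"
      using N(3) C by (simp add: powr_divide powr_diff powr_realpow field_simps)
    also have "ennreal \<dots> \<le> ennreal \<epsilon>"
      using N(2) by (intro ennreal_leI) simp
    finally show ?thesis by simp
  qed
  then have "hausdorff_premeasure s \<delta> E \<le> 0"
    by (rule ennreal_le_epsilon)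
  then show "hausdorff_premeasure s \<delta> E = 0" by simp
qed

text \<open>The hypothesis says that the coordinates in \<open>K\<close> determine a point of \<open>E\<close>, with Lipschitz
  dependence. Cutting each coordinate into intervals of length \<open>1 / N\<close> therefore cuts \<open>E\<close> into
  order of \<open>N\<close> to the power \<open>card K\<close> sets of diameter of order \<open>1 / N\<close>.\<close>
lemma hausdorff_null_if_few_coordinates:
  fixes E :: "'a::euclidean_space set"
  assumes "finite K" "bounded E" "C \<ge> 0" and s: "s > real (card K)"
    and lip: "\<And>x y. x \<in> E \<Longrightarrow> y \<in> E \<Longrightarrow> norm (x - y) \<le> C * (\<Sum>b\<in>K. \<bar>(x - y) \<bullet> b\<bar>)"
  shows "hausdorff_measure s E = 0"
proof -
  obtain R where R: "\<And>x. x \<in> E \<Longrightarrow> norm x \<le> R" using assms(2) by (auto simp: bounded_iff)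
  obtain R' where R': "\<And>b. b \<in> K \<Longrightarrow> norm b \<le> R'"
    using finite_imp_bounded[OF assms(1)] by (auto simp: bounded_iff)
  obtain M :: nat where M: "R * R' \<le> real M" using real_arch_simple by blast
  have coord: "\<bar>x \<bullet> b\<bar> \<le> real M" if "x \<in> E" "b \<in> K" for x b
  proof -
    have "\<bar>x \<bullet> b\<bar> \<le> norm x * norm b" by (rule Cauchy_Schwarz_ineq2)
    also have "\<dots> \<le> R * R'"
      using R[OF that(1)] R'[OF that(2)] by (intro mult_mono) (auto intro: order_trans[OF norm_ge_zero])
    finally show ?thesis using M by simp
  qed
  define q where "q = card K"
  show ?thesis
  proof (rule hausdorff_null_if_box_count[of "C * real q + 1" "(2 * real M + 1) ^ q" q])
    show "C * real q + 1 > 0" using assms(3) by (simp add: add_nonneg_pos)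
    show "real q < s" using s by (simp add: q_def)
    show "(2 * real M + 1) ^ q \<ge> 0" by simp
    fix N :: nat assume N: "N \<ge> 1"
    define cell where "cell x = restrict (\<lambda>b. \<lfloor>real N * (x \<bullet> b)\<rfloor>) K" for x
    define F where "F = (\<lambda>c. {x \<in> E. cell x = c}) ` (cell ` E)"
    let ?P = "PiE K (\<lambda>_. {- int (N * M)..int (N * M)})"
    have sub: "cell ` E \<subseteq> ?P"
    proof (rule image_subsetI, rule PiE_I)
      fix x b assume xb: "x \<in> E" "b \<in> K"
      have "\<bar>real N * (x \<bullet> b)\<bar> \<le> real N * real M"
        using coord[OF xb] by (simp add: abs_mult mult_left_mono)
      then have "- real_of_int (int (N * M)) \<le> real N * (x \<bullet> b)" "real N * (x \<bullet> b) \<le> real_of_int (int (N * M))"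
        by (auto simp: abs_le_iff)
      then have "- int (N * M) \<le> \<lfloor>real N * (x \<bullet> b)\<rfloor>" "\<lfloor>real N * (x \<bullet> b)\<rfloor> \<le> int (N * M)"
        by (auto simp: le_floor_iff floor_le_iff)
      then show "cell x b \<in> {- int (N * M)..int (N * M)}" using xb by (simp add: cell_def)
    qed (simp add: cell_def)
    have finP: "finite ?P" using assms(1) by (intro finite_PiE) auto
    have fin: "finite (cell ` E)" using finite_subset[OF sub finP] .
    have "real (card F) \<le> real (card ?P)"
      unfolding F_def using card_image_le[OF fin] card_mono[OF finP sub] by (meson of_nat_mono order_trans)
    also have "card ?P = (2 * N * M + 1) ^ q"
      using assms(1) by (simp add: card_PiE q_def nat_add_distrib nat_mult_distrib mult_ac)
    also have "real \<dots> \<le> ((2 * real M + 1) * real N) ^ q"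
    proof -
      have "real (2 * N * M + 1) \<le> (2 * real M + 1) * real N"
        using N by (simp add: algebra_simps)
      then show ?thesis unfolding of_nat_power by (intro power_mono) auto
    qed
    also have "\<dots> = (2 * real M + 1) ^ q * real N ^ q" by (rule power_mult_distrib)
    finally have card: "real (card F) \<le> (2 * real M + 1) ^ q * real N ^ q" .
    have diam: "bounded U \<and> diameter U \<le> (C * real q + 1) / real N" if UF: "U \<in> F" for U
    proof -
      obtain c where U: "U = {x \<in> E. cell x = c}" using UF by (auto simp: F_def)
      have "norm (x - y) \<le> (C * real q + 1) / real N" if "x \<in> U" "y \<in> U" for x y
      proof -
        have "\<bar>(x - y) \<bullet> b\<bar> \<le> 1 / real N" if b: "b \<in> K" for b
        proof -
          have "cell x b = cell y b" using \<open>x \<in> U\<close> \<open>y \<in> U\<close> U by auto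
          then have "\<lfloor>real N * (x \<bullet> b)\<rfloor> = \<lfloor>real N * (y \<bullet> b)\<rfloor>" using b by (simp add: cell_def)
          then have "\<bar>real N * (x \<bullet> b) - real N * (y \<bullet> b)\<bar> \<le> 1" by linarith
          then have "real N * \<bar>(x - y) \<bullet> b\<bar> \<le> 1"
            by (simp add: inner_diff_left right_diff_distrib[symmetric] abs_mult)
          then show ?thesis using N by (simp add: field_simps)
        qed
        then have "(\<Sum>b\<in>K. \<bar>(x - y) \<bullet> b\<bar>) \<le> real q * (1 / real N)"
          using sum_bounded_above[of K "\<lambda>b. \<bar>(x - y) \<bullet> b\<bar>" "1 / real N"] by (simp add: q_def)
        then have "C * (\<Sum>b\<in>K. \<bar>(x - y) \<bullet> b\<bar>) \<le> C * (real q * (1 / real N))"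
          using assms(3) by (intro mult_left_mono)
        also have "\<dots> \<le> (C * real q + 1) / real N" using N by (simp add: field_simps)
        finally show ?thesis using lip[of x y] that U by auto
      qed
      moreover have "0 \<le> (C * real q + 1) / real N" using assms(3) by simp
      moreover have "bounded U" using bounded_subset[OF assms(2)] U by auto
      ultimately show ?thesis by (auto intro: diameter_le)
    qed
    show "\<exists>F. finite F \<and> real (card F) \<le> (2 * real M + 1) ^ q * real N ^ q \<and> E \<subseteq> \<Union>F \<and>
         (\<forall>U\<in>F. bounded U \<and> diameter U \<le> (C * real q + 1) / real N)"
      using card diam fin by (intro exI[of _ F]) (auto simp: F_def)
  qed
qed

section \<open>Zero sets of monogenic functions\<close>

context clifford_frame
begin

lemma conj_mult_self: "e \<in> B \<Longrightarrow> cj e * e = 1"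
proof -
  assume "e \<in> B"
  then have "cj e * e + cj e * e = 1 + 1" using clifford[of e e] by simp
  then have "2 *\<^sub>R (cj e * e) = 2 *\<^sub>R 1" by (simp add: scaleR_2)
  then show "cj e * e = 1" by simp
qed

text \<open>The hypothesis says that the vector \<open>\<xi>\<close> with coordinates \<open>k e\<close> satisfies \<open>\<xi> * a = 0\<close>.
  Multiplication by the conjugate of \<open>\<xi>\<close> turns this into the squared norm of \<open>\<xi>\<close> times \<open>a\<close>.\<close>
lemma dirac_rank_one_zero:
  assumes dirac: "(\<Sum>e\<in>B. e * (k e *\<^sub>R a)) = 0" and e: "e \<in> B"
  shows "k e *\<^sub>R a = 0"
proof -
  have "(\<Sum>e\<in>B. (k e * k e) *\<^sub>R a) = (\<Sum>e\<in>B. cj e * (\<Sum>e'\<in>B. e' * ((k e * k e') *\<^sub>R a)))"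
    by (rule sum_conj_symmetric[symmetric]) (simp add: mult.commute)
  also have "\<dots> = (\<Sum>e\<in>B. cj e * (k e *\<^sub>R (\<Sum>e'\<in>B. e' * (k e' *\<^sub>R a))))"
    by (simp add: scaleR_sum_right)
  also have "\<dots> = 0" by (simp only: dirac) simp
  finally have "(\<Sum>e\<in>B. k e * k e) *\<^sub>R a = 0" by (simp add: scaleR_sum_left)
  moreover have "k e = 0" if "(\<Sum>e\<in>B. k e * k e) = 0"
    using that e finite_frame by (simp add: sum_nonneg_eq_0_iff)
  ultimately show ?thesis by auto
qed

lemma independent_frame: "independent B"
proof (rule pairwise_orthogonal_independent)
  show "pairwise orthogonal B" by (auto simp: pairwise_def orthogonal_def orthonormal)
  show "0 \<notin> B" using orthonormal by force
qed

lemma dim_span_frame: "dim (span B) = card B"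
  using independent_frame by (simp add: dim_eq_card_independent)

text \<open>Otherwise the complement of the kernel in the span is at most a line, and \<open>L\<close> maps the
  frame to multiples of a single vector, which \<open>dirac_rank_one_zero\<close> excludes.\<close>
lemma dirac_kernel_dim:
  fixes L :: "'a \<Rightarrow>\<^sub>L 'a"
  assumes dirac: "(\<Sum>e\<in>B. e * L e) = 0" and nz: "e0 \<in> B" "L e0 \<noteq> 0"
  shows "dim {w \<in> span B. L w = 0} + 2 \<le> card B"
proof -
  define K where "K = {w \<in> span B. L w = 0}"
  define N where "N = {y \<in> span B. \<forall>x\<in>K. orthogonal x y}"
  have K: "subspace K"
    unfolding K_def subspace_def by (auto simp: span_zero span_add span_scale blinfun.bilinear_simps)
  have dims: "dim N + dim K = card B"
    unfolding N_def dim_span_frame[symmetric]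
    by (rule dim_subspace_orthogonal_to_vectors[OF K]) (auto simp: K_def)
  have "dim N \<ge> 2"
  proof (rule ccontr)
    assume "\<not> dim N \<ge> 2"
    moreover obtain Bn where Bn: "Bn \<subseteq> N" "independent Bn" "N \<subseteq> span Bn" "card Bn = dim N"
      using basis_exists by blast
    ultimately have "card Bn \<le> 1" by simp
    moreover have "finite Bn" using Bn(2) by (rule independent_imp_finite)
    ultimately obtain \<xi> where "Bn \<subseteq> {\<xi>}"
      by (metis card_le_Suc0_iff_eq One_nat_def empty_subsetI singletonI subsetI subset_eq empty_iff)
    then have N\<xi>: "N \<subseteq> span {\<xi>}" using Bn(3) span_mono by blast
    have "\<exists>k. L e = k *\<^sub>R L \<xi>" if e: "e \<in> B" for e
    proof -
      \<comment> \<open>Only the component \<open>z\<close> of \<open>e\<close> orthogonal to the kernel contributes to \<open>L e\<close>.\<close>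
      obtain y z where yz: "y \<in> span K" "\<And>w. w \<in> span K \<Longrightarrow> orthogonal z w" "e = y + z"
        using orthogonal_subspace_decomp_exists by metis
      then have yK: "y \<in> K" using K by (simp add: span_eq_iff[THEN iffD2])
      have "z = e - y" using yz(3) by simp
      then have "z \<in> span B" using e yK by (simp add: K_def span_base span_diff)
      then have "z \<in> N" using yz(2) by (auto simp: N_def span_base orthogonal_commute)
      then obtain k where "z = k *\<^sub>R \<xi>" using N\<xi> by (auto simp: span_singleton)
      then have "L e = k *\<^sub>R L \<xi>" using yK yz(3) by (simp add: K_def blinfun.bilinear_simps)
      then show ?thesis by blast
    qed
    then obtain k where k: "\<And>e. e \<in> B \<Longrightarrow> L e = k e *\<^sub>R L \<xi>" by metis
    have "(\<Sum>e\<in>B. e * (k e *\<^sub>R L \<xi>)) = 0"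
      using dirac k by (metis (no_types, lifting) sum.cong)
    from dirac_rank_one_zero[OF this nz(1)] show False using k nz by simp
  qed
  then show ?thesis using dims unfolding K_def by linarith
qed

text \<open>On the complement of its kernel the differential \<open>L\<close> at \<open>p\<close> is bounded below by some
  \<open>c > 0\<close>. For two zeros \<open>x\<close> and \<open>y\<close> of \<open>u\<close> near \<open>p\<close> the mean value inequality makes \<open>L (x - y)\<close>
  small compared with \<open>c\<close> times the distance, so the component of \<open>x - y\<close> along the kernel
  dominates, and at most \<open>card B - 2\<close> coordinates determine a zero.\<close>
lemma regular_zero_set_null:
  assumes mono: "monogenic U u" and p: "p \<in> U" and nz: "dd w u p \<noteq> 0"
    and s: "s > real (card B) - 2"
  shows "\<exists>r>0. hausdorff_measure s {x \<in> ball p r \<inter> span B. u x = 0} = 0"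
proof -
  obtain D where mono': "monogenic_deriv U u D" using mono by (auto simp: monogenic_def)
  note D = monogenic_derivD[OF mono']
  define L where "L = D p"
  have "L w \<noteq> 0" using nz dd_eq_deriv[OF mono' p] by (simp add: L_def)
  then obtain e0 where e0: "e0 \<in> B" "L e0 \<noteq> 0"
    using D(5)[OF p, of w] unfolding L_def
    by (metis (no_types, lifting) scaleR_zero_right sum.neutral)
  define K where "K = {w \<in> span B. L w = 0}"
  define N where "N = {y \<in> span B. \<forall>x\<in>K. orthogonal x y}"
  have dimK: "dim K + 2 \<le> card B"
    unfolding K_def by (rule dirac_kernel_dim[OF _ e0]) (use D(4)[OF p] in \<open>simp add: L_def\<close>)
  have K: "subspace K"
    unfolding K_def subspace_def by (auto simp: span_zero span_add span_scale blinfun.bilinear_simps)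
  have N: "subspace N"
    unfolding N_def subspace_def
    by (auto simp: span_zero span_add span_scale orthogonal_def inner_add_right)
  obtain Bk where Bk: "Bk \<subseteq> K" "pairwise orthogonal Bk" "\<And>x. x \<in> Bk \<Longrightarrow> norm x = 1"
    "independent Bk" "card Bk = dim K" "span Bk = K"
    using orthonormal_basis_subspace[OF K] by metis
  have finBk: "finite Bk" using Bk(4) by (rule independent_imp_finite)
  have "\<exists>c>0. \<forall>x\<in>N. norm (L x) \<ge> c * norm x"
  proof (rule injective_imp_isometric[OF closed_subspace[OF N] N])
    show "bounded_linear L" by (rule blinfun.bounded_linear_right)
    show "\<forall>x\<in>N. L x = 0 \<longrightarrow> x = 0"
      unfolding N_def K_def by (auto simp: orthogonal_def)
  qed
  then obtain c where c: "c > 0" "\<And>x. x \<in> N \<Longrightarrow> norm (L x) \<ge> c * norm x" by blast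
  have "isCont D p" using D(1,2) p by (simp add: continuous_on_eq_continuous_at)
  then obtain r1 where r1: "r1 > 0" "\<And>x. dist x p < r1 \<Longrightarrow> dist (D x) (D p) < c / 2"
    unfolding continuous_at_eps_delta using c by (metis half_gt_zero)
  obtain r2 where r2: "r2 > 0" "ball p r2 \<subseteq> U" using D(1) p open_contains_ball by blast
  define r where "r = min r1 r2"
  have r: "r > 0" using r1 r2 by (simp add: r_def)
  have "norm (x - y) \<le> 2 * (\<Sum>b\<in>Bk. \<bar>(x - y) \<bullet> b\<bar>)"
    if x: "x \<in> ball p r \<inter> span B" "u x = 0" and y: "y \<in> ball p r \<inter> span B" "u y = 0" for x y
  proof -
    define z where "z = x - y"
    have zW: "z \<in> span B" using x y by (simp add: z_def span_diff)
    obtain k n where kn: "k \<in> span K" "\<And>w. w \<in> span K \<Longrightarrow> orthogonal n w" "z = k + n"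
      using orthogonal_subspace_decomp_exists by metis
    then have kK: "k \<in> K" using K by (simp add: span_eq_iff[THEN iffD2])
    have "n = z - k" using kn(3) by simp
    then have "n \<in> span B" using zW kK by (simp add: K_def span_diff)
    then have nN: "n \<in> N" using kn(2) by (auto simp: N_def span_base orthogonal_commute)
    \<comment> \<open>The coordinates of \<open>z\<close> along the basis \<open>Bk\<close> of the kernel are those of its component
        \<open>k\<close>.\<close>
    have zk: "z \<bullet> b = k \<bullet> b" if "b \<in> Bk" for b
      using kn(2)[of b] kn(3) that Bk(1) by (auto simp: orthogonal_def inner_add_left span_base)
    have "norm (u x - u y - D p (x - y)) \<le> norm (x - y) * (c / 2)"
    proof (rule differentiable_bound_linearization[of y x "ball p r" u D p])
      show "y + t *\<^sub>R (x - y) \<in> ball p r" if "t \<in> {0..1}" for t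
      proof -
        have "(1 - t) *\<^sub>R y + t *\<^sub>R x \<in> ball p r"
          using convexD[OF convex_ball, of y p r x "1 - t" t] x y that by auto
        then show ?thesis by (simp add: algebra_simps)
      qed
      show "(u has_derivative D q) (at q within ball p r)" if "q \<in> ball p r" for q
        by (rule has_derivative_at_withinI[OF D(3)]) (use that r2 in \<open>auto simp: r_def\<close>)
      show "onorm (blinfun_apply (D q) - blinfun_apply (D p)) \<le> c / 2" if "q \<in> ball p r" for q
      proof -
        have "dist (D q) (D p) \<le> c / 2" using r1(2)[of q] that by (auto simp: r_def dist_commute)
        moreover have "blinfun_apply (D q) - blinfun_apply (D p) = blinfun_apply (D q - D p)"
          by (rule ext) (simp add: blinfun.diff_left)
        ultimately show ?thesis by (simp add: dist_norm norm_blinfun.rep_eq)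
      qed
      show "p \<in> ball p r" using r by simp
    qed
    then have "norm (L z) \<le> norm z * (c / 2)" using x y by (simp add: L_def z_def)
    moreover have "L z = L n" using kK kn(3) by (simp add: K_def blinfun.bilinear_simps)
    ultimately have "c * norm n \<le> c * (norm z / 2)" using c(2)[OF nN] by (simp add: mult_ac)
    then have n: "norm n \<le> norm z / 2" using c(1) by simp
    have "norm k \<le> (\<Sum>b\<in>Bk. \<bar>z \<bullet> b\<bar>)"
    proof -
      have "k = (\<Sum>b\<in>Bk. (k \<bullet> b) *\<^sub>R b)"
        using orthonormal_basis_expand[OF Bk(2,3) _ finBk, of k] kK Bk(6) by (simp add: inner_commute)
      then have "norm k \<le> (\<Sum>b\<in>Bk. norm ((k \<bullet> b) *\<^sub>R b))" by (metis norm_sum)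
      also have "\<dots> = (\<Sum>b\<in>Bk. \<bar>z \<bullet> b\<bar>)" by (intro sum.cong) (simp_all add: Bk(3) zk)
      finally show ?thesis .
    qed
    moreover have "norm z \<le> norm k + norm n" using kn(3) norm_triangle_ineq by blast
    ultimately show ?thesis using n by (simp add: z_def)
  qed
  moreover have "bounded {x \<in> ball p r \<inter> span B. u x = 0}"
    by (rule bounded_subset[OF bounded_ball[of p r]]) auto
  moreover have "real (card Bk) < s" using dimK Bk(5) s by linarith
  ultimately have "hausdorff_measure s {x \<in> ball p r \<inter> span B. u x = 0} = 0"
    by (intro hausdorff_null_if_few_coordinates[OF finBk, of _ 2]) auto
  then show ?thesis using r by blast
qed

text \<open>Each zero has a shortest list of directions whose iterated derivative is nonzero, because
  otherwise the function would be flat there. There are countably many lists, and by the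
  Lindelof property countably many balls suffice for each of them.\<close>
theorem zero_set_null:
  assumes mono: "monogenic U H" and X: "connected X" "X \<subseteq> U \<inter> span B"
    and nz: "x0 \<in> X" "H x0 \<noteq> 0" and s: "s > real (card B) - 2"
  shows "hausdorff_measure s {x \<in> X. H x = 0} = 0"
proof -
  define Z where "Z us = {x \<in> X. foldr dd us H x = 0 \<and> (\<exists>w. dd w (foldr dd us H) x \<noteq> 0)}" for us
  have "hausdorff_measure s (Z us) = 0" for us
  proof -
    let ?u = "foldr dd us H"
    have "\<exists>r>0. hausdorff_measure s {x \<in> ball p r \<inter> span B. ?u x = 0} = 0" if p: "p \<in> Z us" for p
    proof -
      obtain w where "p \<in> U" "dd w ?u p \<noteq> 0" using p X by (auto simp: Z_def)
      then show ?thesis using regular_zero_set_null[OF monogenic_foldr_dd[OF mono] _ _ s] by blast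
    qed
    then obtain r where r: "\<And>p. p \<in> Z us \<Longrightarrow> r p > 0"
      "\<And>p. p \<in> Z us \<Longrightarrow> hausdorff_measure s {x \<in> ball p (r p) \<inter> span B. ?u x = 0} = 0"
      by metis
    obtain F where F: "F \<subseteq> (\<lambda>p. ball p (r p)) ` Z us" "countable F"
      "\<Union>F = (\<Union>p\<in>Z us. ball p (r p))"
      using Lindelof[of "(\<lambda>p. ball p (r p)) ` Z us"] by (metis (no_types, lifting) imageE open_ball)
    have "hausdorff_measure s (\<Union>Y\<in>F. {x \<in> Y \<inter> span B. ?u x = 0}) = 0"
    proof (rule hausdorff_null_UN[OF F(2)])
      fix Y assume "Y \<in> F"
      then obtain p where "p \<in> Z us" "Y = ball p (r p)" using F(1) by blast
      then show "hausdorff_measure s {x \<in> Y \<inter> span B. ?u x = 0} = 0" using r(2) by simp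
    qed
    moreover have "Z us \<subseteq> (\<Union>Y\<in>F. {x \<in> Y \<inter> span B. ?u x = 0})"
    proof
      fix x assume x: "x \<in> Z us"
      then have "x \<in> ball x (r x)" using r(1) by simp
      then have "x \<in> \<Union>F" using x F(3) by blast
      then show "x \<in> (\<Union>Y\<in>F. {x \<in> Y \<inter> span B. ?u x = 0})"
        using x X by (auto simp: Z_def)
    qed
    ultimately show ?thesis by (rule hausdorff_null_subset)
  qed
  then have "hausdorff_measure s (\<Union>us\<in>lists B. Z us) = 0"
    by (intro hausdorff_null_UN countable_lists countable_finite finite_frame)
  moreover have "{x \<in> X. H x = 0} \<subseteq> (\<Union>us\<in>lists B. Z us)"
  proof
    fix x assume x: "x \<in> {x \<in> X. H x = 0}"
    have "\<not> flat H x"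
      using flat_identity[OF mono X(1), of x x0] X(2) x nz by auto
    then obtain us where "us \<in> lists B \<and> foldr dd us H x \<noteq> 0" by (auto simp: flat_def)
    \<comment> \<open>A shortest list is not empty, since \<open>H x = 0\<close>; its tail therefore gives a derivative
        that vanishes at \<open>x\<close> to first order exactly.\<close>
    then obtain us where us: "us \<in> lists B" "foldr dd us H x \<noteq> 0"
      and min: "\<And>vs. length vs < length us \<Longrightarrow> vs \<in> lists B \<Longrightarrow> foldr dd vs H x = 0"
      using ex_has_least_nat[of "\<lambda>us. us \<in> lists B \<and> foldr dd us H x \<noteq> 0" us length]
      by (metis linorder_not_le)
    then obtain w vs where "us = w # vs" using x by (cases us) auto
    then have "x \<in> Z vs" "vs \<in> lists B" using us min[of vs] x by (auto simp: Z_def)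
    then show "x \<in> (\<Union>us\<in>lists B. Z us)" by blast
  qed
  ultimately show ?thesis by (rule hausdorff_null_subset)
qed

text \<open>Tangential derivatives vanish trivially; the Cauchy-Riemann equation then leaves only the
  term of the normal direction \<open>b\<close>, and \<open>b\<close> is invertible.\<close>
lemma derivs_vanish_on_hyperplane:
  assumes mono: "monogenic U u" and b: "b \<in> B"
    and zero: "\<And>x. x \<in> U \<inter> span (B - {b}) \<Longrightarrow> u x = 0"
    and x: "x \<in> U \<inter> span (B - {b})" and w: "w \<in> B"
  shows "dd w u x = 0"
proof -
  obtain D where mono': "monogenic_deriv U u D" using mono by (auto simp: monogenic_def)
  note D = monogenic_derivD[OF mono']
  have xU: "x \<in> U" using x by simp
  have tangential: "D x e = 0" if e: "e \<in> B - {b}" for e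
  proof -
    have "((\<lambda>r. u (x + r *\<^sub>R e)) has_derivative (\<lambda>h. D x (h *\<^sub>R e))) (at 0)"
      by (rule has_derivative_compose[where f = "\<lambda>r. x + r *\<^sub>R e" and g = u])
         (auto intro!: derivative_eq_intros D(3) xU)
    then have "((\<lambda>r. u (x + r *\<^sub>R e)) has_vector_derivative D x e) (at 0)"
      by (simp add: has_vector_derivative_def blinfun.scaleR_right)
    moreover have "((\<lambda>r. u (x + r *\<^sub>R e)) has_vector_derivative 0) (at 0)"
    proof (rule has_vector_derivative_transform_within_open[of "\<lambda>_. 0" _ _ "(\<lambda>r. x + r *\<^sub>R e) -` U"])
      show "open ((\<lambda>r. x + r *\<^sub>R e) -` U)"
        by (intro open_vimage D(1) continuous_intros)
      show "0 = u (x + r *\<^sub>R e)" if "r \<in> (\<lambda>r. x + r *\<^sub>R e) -` U" for r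
        using that x e by (intro zero[symmetric]) (auto intro: span_add span_scale span_base)
    qed (use xU in auto)
    ultimately show ?thesis by (rule vector_derivative_unique_at)
  qed
  have "(\<Sum>e\<in>B. e * D x e) = b * D x b + (\<Sum>e\<in>B - {b}. e * D x e)"
    by (rule sum.remove[OF finite_frame b])
  then have "b * D x b = 0" using D(4)[OF xU] tangential by simp
  then have "cj b * b * D x b = 0" by (simp add: mult.assoc)
  then have "D x b = 0" using conj_mult_self[OF b] by simp
  then show ?thesis using tangential w dd_eq_deriv[OF mono' xU] by (cases "w = b") auto
qed

theorem hyperplane_identity:
  assumes mono: "monogenic U H" and b: "b \<in> B"
    and zero: "\<And>x. x \<in> U \<inter> span (B - {b}) \<Longrightarrow> H x = 0"
    and X: "connected X" "X \<subseteq> U" and p: "p \<in> X \<inter> span (B - {b})" and x: "x \<in> X"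
  shows "H x = 0"
proof (rule flat_identity[OF mono X _ _ x])
  show "p \<in> X" using p by simp
  have "foldr dd us H y = 0" if "us \<in> lists B" "y \<in> U \<inter> span (B - {b})" for us y
    using that
  proof (induction us arbitrary: y)
    case Nil
    then show ?case using zero by simp
  next
    case (Cons w us)
    then show ?case
      using derivs_vanish_on_hyperplane[OF monogenic_foldr_dd[OF mono] b, of us y w] by auto
  qed
  then show "flat H p" unfolding flat_def using p X by blast
qed

end

section \<open>Frames of slices and cylindrical extension\<close>

lemma span_images_orthogonal:
  fixes v :: "nat \<Rightarrow> 'a::euclidean_space"
  assumes on: "\<And>i j. i \<le> d \<Longrightarrow> j \<le> d \<Longrightarrow> v i \<bullet> v j = (if i = j then 1 else 0)"
    and ST: "S \<subseteq> {..d}" "T \<subseteq> {..d}" "S \<inter> T = {}"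
    and x: "x \<in> span (v ` S)" and y: "y \<in> span (v ` T)"
  shows "x \<bullet> y = 0"
proof -
  have "orthogonal (v i) y" if i: "i \<in> S" for i
  proof (rule orthogonal_to_span[OF y])
    fix z assume "z \<in> v ` T"
    then obtain j where "j \<in> T" "z = v j" by blast
    moreover from this have "i \<le> d" "j \<le> d" "i \<noteq> j" using i ST by auto
    ultimately show "orthogonal (v i) z" using on[of i j] by (simp add: orthogonal_def)
  qed
  then have "orthogonal y z" if "z \<in> v ` S" for z
    using that by (auto simp: orthogonal_commute)
  then have "orthogonal y x" by (rule orthogonal_to_span[OF x])
  then show ?thesis by (simp add: orthogonal_def inner_commute)
qed

text \<open>The properties of a hypercomplex basis and its orthonormal completion that the slice
  geometry depends on.\<close>
locale regular_setting =
  fixes v :: "nat \<Rightarrow> 'a::{real_algebra_1,euclidean_space}" and n \<tau> :: nat and t :: "nat \<Rightarrow> nat"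
  assumes n: "1 \<le> n" and v0: "v 0 = 1"
    and square: "s \<in> {1..n} \<Longrightarrow> v s * v s = - 1"
    and anticommute: "s \<in> {1..n} \<Longrightarrow> u \<in> {1..n} \<Longrightarrow> s \<noteq> u \<Longrightarrow> v s * v u = - (v u * v s)"
    and orthonormal_v: "i \<le> n \<Longrightarrow> j \<le> n \<Longrightarrow> v i \<bullet> v j = (if i = j then 1 else 0)"
    and steps: "step_list n \<tau> t"
begin

lemma step_mono: "i \<le> j \<Longrightarrow> j \<le> \<tau> \<Longrightarrow> t i \<le> t j"
  using steps unfolding step_list_def strict_mono_on_def by (cases "i = j") (auto intro: less_imp_le)

lemma step_strict: "i < j \<Longrightarrow> j \<le> \<tau> \<Longrightarrow> t i < t j"
  using steps unfolding step_list_def strict_mono_on_def by auto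

lemma step_le: "i \<le> \<tau> \<Longrightarrow> t i \<le> n"
  using step_mono[of i \<tau>] steps unfolding step_list_def by simp

lemma mirror_dim_pos: "1 \<le> t 0 + \<tau>"
  using n steps unfolding step_list_def by (cases "\<tau> = 0") auto

text \<open>The indices of the sphere that the component of index \<open>h\<close> of the torus lives in.\<close>
abbreviation block :: "nat \<Rightarrow> nat set" where
  "block h \<equiv> {t (h - 1) + 1..t h}"

lemma block_subset: "h \<in> {1..\<tau>} \<Longrightarrow> block h \<subseteq> {t 0 + 1..n}"
  using step_le[of h] step_mono[of 0 "h - 1"] by auto

lemma block_disjoint:
  assumes "h \<in> {1..\<tau>}" "k \<in> {1..\<tau>}" "h \<noteq> k"
  shows "block h \<inter> block k = {}"
proof -
  have "block h \<inter> block k = {}" if "h \<in> {1..\<tau>}" "k \<in> {1..\<tau>}" "h < k" for h k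
  proof -
    have "t h \<le> t (k - 1)" using that by (intro step_mono) auto
    then show ?thesis by auto
  qed
  from this[of h k] this[of k h] show ?thesis using assms by (cases "h < k") auto
qed

lemma block_ne: "h \<in> {1..\<tau>} \<Longrightarrow> t h \<in> block h"
  using step_strict[of "h - 1" h] by auto

lemma blocks_cover: "k \<le> \<tau> \<Longrightarrow> {..t k} = {..t 0} \<union> (\<Union>h\<in>{1..k}. block h)"
proof (induction k)
  case 0
  then show ?case by simp
next
  case (Suc k)
  have "t k \<le> t (Suc k)" using Suc.prems by (intro step_mono) auto
  then have "{..t (Suc k)} = {..t k} \<union> block (Suc k)" by auto
  also have "\<dots> = {..t 0} \<union> (\<Union>h\<in>{1..k}. block h) \<union> block (Suc k)"
    using Suc by simp
  also have "\<dots> = {..t 0} \<union> (\<Union>h\<in>{1..Suc k}. block h)"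
    by (simp add: atLeastAtMostSuc_conv Un_ac)
  finally show ?case .
qed

text \<open>The product of imaginary vectors is determined by the inner product up to an antisymmetric
  part. Bilinearity reduces this to basis vectors.\<close>
lemma imaginary_product:
  assumes x: "x \<in> span (v ` {1..n})" and y: "y \<in> span (v ` {1..n})"
  shows "x * y + y * x = - (2 * (x \<bullet> y)) *\<^sub>R 1"
proof -
  have gen: "v i * y + y * v i = - (2 * (v i \<bullet> y)) *\<^sub>R 1" if i: "i \<in> {1..n}" for i
    using y
  proof (induction rule: span_induct_alt)
    case base
    then show ?case by simp
  next
    case (step c z y)
    then obtain j where j: "j \<in> {1..n}" "z = v j" by blast
    have "v i * z + z * v i = - (2 * (v i \<bullet> z)) *\<^sub>R 1"
    proof (cases "i = j")
      case True
      then show ?thesis using square[OF i] orthonormal_v[of i i] i j by (simp add: scaleR_2[symmetric])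
    next
      case False
      then show ?thesis using anticommute[OF i j(1)] orthonormal_v[of i j] i j by simp
    qed
    then have "v i * (c *\<^sub>R z + y) + (c *\<^sub>R z + y) * v i =
        c *\<^sub>R (- (2 * (v i \<bullet> z)) *\<^sub>R 1) + (- (2 * (v i \<bullet> y)) *\<^sub>R 1)"
      using step.IH by (simp add: algebra_simps flip: scaleR_add_right)
    then show ?case by (simp add: inner_add_right algebra_simps flip: scaleR_add_left)
  qed
  show ?thesis
    using x
  proof (induction rule: span_induct_alt)
    case base
    then show ?case by simp
  next
    case (step c z x)
    then obtain i where "i \<in> {1..n}" "z = v i" by blast
    then have "(c *\<^sub>R z + x) * y + y * (c *\<^sub>R z + x) =
        c *\<^sub>R (- (2 * (z \<bullet> y)) *\<^sub>R 1) + (- (2 * (x \<bullet> y)) *\<^sub>R 1)"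
      using step.IH gen[of i] by (simp add: algebra_simps flip: scaleR_add_right)
    then show ?case by (simp add: inner_add_left algebra_simps flip: scaleR_add_left)
  qed
qed

definition frame :: "(nat \<Rightarrow> 'a) \<Rightarrow> 'a set" where
  "frame J = v ` {..t 0} \<union> J ` {1..\<tau>}"

definition frame_conj :: "'a \<Rightarrow> 'a" where
  "frame_conj e = (if e = 1 then 1 else - e)"

lemma torusD:
  assumes "J \<in> torus v \<tau> t" "h \<in> {1..\<tau>}"
  shows "J h \<in> span (v ` block h)" "norm (J h) = 1"
  using assms unfolding torus_def subsphere_def subspan_def by auto

lemma torus_inner:
  assumes J: "J \<in> torus v \<tau> t" and h: "h \<in> {1..\<tau>}" "k \<in> {1..\<tau>}"
  shows "J h \<bullet> J k = (if h = k then 1 else 0)"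
proof (cases "h = k")
  case True
  then show ?thesis using torusD(2)[OF J h(1)] by (simp add: dot_square_norm)
next
  case False
  then have "block h \<inter> block k = {}" using h by (intro block_disjoint)
  moreover have "block h \<subseteq> {..n}" "block k \<subseteq> {..n}" using block_subset h by force+
  ultimately show ?thesis
    using span_images_orthogonal[OF orthonormal_v _ _ _ torusD(1)[OF J h(1)] torusD(1)[OF J h(2)]] False
    by simp
qed

lemma mirror_torus_inner:
  assumes J: "J \<in> torus v \<tau> t" and h: "h \<in> {1..\<tau>}" and s: "s \<le> t 0"
  shows "v s \<bullet> J h = 0"
proof (rule span_images_orthogonal[OF orthonormal_v _ _ _ _ torusD(1)[OF J h]])
  show "v s \<in> span (v ` {s})" by (simp add: span_base)
  show "block h \<subseteq> {..n}" using block_subset[OF h] by force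
  show "{s} \<subseteq> {..n}" using s step_le[of 0] by auto
  show "{s} \<inter> block h = {}" using block_subset[OF h] s by force
qed auto

lemma imaginary_frame:
  assumes J: "J \<in> torus v \<tau> t" and e: "e \<in> frame J" "e \<noteq> 1"
  shows "e \<in> span (v ` {1..n})"
proof -
  from e(1) consider s where "s \<le> t 0" "e = v s" | h where "h \<in> {1..\<tau>}" "e = J h"
    by (auto simp: frame_def)
  then show ?thesis
  proof cases
    case 1
    then have "s \<noteq> 0" using e(2) v0 by metis
    then show ?thesis using 1 step_le[of 0] by (auto intro!: span_base)
  next
    case 2
    have "block h \<subseteq> {1..n}" using block_subset[OF 2(1)] by force
    then have "span (v ` block h) \<subseteq> span (v ` {1..n})" by (intro span_mono image_mono)
    then show ?thesis using torusD(1)[OF J 2(1)] 2 by auto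
  qed
qed

lemma frame_orthonormal:
  assumes J: "J \<in> torus v \<tau> t" and e: "e \<in> frame J" "e' \<in> frame J"
  shows "e \<bullet> e' = (if e = e' then 1 else 0)"
proof -
  have vv: "v s \<bullet> v s' = (if v s = v s' then 1 else 0)" if "s \<le> t 0" "s' \<le> t 0" for s s'
    using orthonormal_v[of s s'] orthonormal_v[of s s] that step_le[of 0] by (cases "s = s'") auto
  have vJ: "v s \<bullet> J h = 0 \<and> v s \<noteq> J h" if "s \<le> t 0" "h \<in> {1..\<tau>}" for s h
    using mirror_torus_inner[OF J that(2,1)] torus_inner[OF J that(2,2)] by auto
  have JJ: "J h \<bullet> J k = (if J h = J k then 1 else 0)" if "h \<in> {1..\<tau>}" "k \<in> {1..\<tau>}" for h k
    using torus_inner[OF J that] torus_inner[OF J that(1,1)] by (cases "h = k") auto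
  show ?thesis
    using e unfolding frame_def by (auto simp: vv JJ vJ inner_commute[of "J _" "v _"] dest: vJ)
qed

lemma clifford_frame_frame:
  assumes J: "J \<in> torus v \<tau> t"
  shows "clifford_frame (frame J) frame_conj"
proof
  show "finite (frame J)" by (simp add: frame_def)
  fix e e' assume e: "e \<in> frame J" "e' \<in> frame J"
  show inner: "e \<bullet> e' = (if e = e' then 1 else 0)"
    by (rule frame_orthonormal[OF J e])
  show "frame_conj e * e' + frame_conj e' * e = (if e = e' then 2 else 0)"
  proof (cases "e = 1 \<or> e' = 1")
    case True
    then show ?thesis by (auto simp: frame_conj_def)
  next
    case False
    then have "e * e' + e' * e = - (2 * (e \<bullet> e')) *\<^sub>R 1"
      using imaginary_product imaginary_frame[OF J] e by blast
    then have "- (e * e') + - (e' * e) = (2 * (e \<bullet> e')) *\<^sub>R 1"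
      by (metis minus_add_distrib minus_minus scaleR_minus_left)
    then show ?thesis using False inner by (auto simp: frame_conj_def scaleR_2)
  qed
qed

lemma span_frame: "slice_space v \<tau> t J = span (frame J)"
  by (simp add: slice_space_def frame_def)

lemma frame_sum:
  assumes J: "J \<in> torus v \<tau> t"
  shows "(\<Sum>e\<in>frame J. F e) = (\<Sum>s\<le>t 0. F (v s)) + (\<Sum>h=1..\<tau>. F (J h))"
proof -
  have "inj_on v {..t 0}"
  proof (rule inj_onI)
    fix i j assume "i \<in> {..t 0}" "j \<in> {..t 0}" "v i = v j"
    then show "i = j" using orthonormal_v[of i j] orthonormal_v[of i i] step_le[of 0]
      by (auto split: if_splits)
  qed
  moreover have "inj_on J {1..\<tau>}"
  proof (rule inj_onI)
    fix h k assume "h \<in> {1..\<tau>}" "k \<in> {1..\<tau>}" "J h = J k"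
    then show "h = k" using torus_inner[OF J, of h k] torus_inner[OF J, of h h] by (auto split: if_splits)
  qed
  moreover have "v ` {..t 0} \<inter> J ` {1..\<tau>} = {}"
  proof -
    have "v s \<noteq> J h" if "s \<le> t 0" "h \<in> {1..\<tau>}" for s h
      using mirror_torus_inner[OF J that(2,1)] torus_inner[OF J that(2,2)] by auto
    then show ?thesis by blast
  qed
  ultimately show ?thesis
    unfolding frame_def by (simp add: sum.union_disjoint sum.reindex)
qed

lemma card_frame: "J \<in> torus v \<tau> t \<Longrightarrow> card (frame J) = t 0 + 1 + \<tau>"
  using frame_sum[of J "\<lambda>_. 1::nat"] by simp

definition proj :: "(nat \<Rightarrow> 'a) \<Rightarrow> 'a \<Rightarrow> 'a" where
  "proj J x = (\<Sum>e\<in>frame J. (x \<bullet> e) *\<^sub>R e)"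

lemma bounded_linear_proj: "bounded_linear (proj J)"
  unfolding proj_def[abs_def]
  by (intro bounded_linear_sum bounded_linear_compose[OF bounded_linear_scaleR_left] bounded_linear_inner_left)

lemma proj_in_span: "proj J x \<in> span (frame J)"
  unfolding proj_def by (intro span_sum span_scale span_base)

lemma proj_eq_self:
  assumes J: "J \<in> torus v \<tau> t" and x: "x \<in> span (frame J)"
  shows "proj J x = x"
  using x
proof (induction rule: span_induct_alt)
  case base
  then show ?case by (simp add: proj_def)
next
  case (step c z x)
  interpret bounded_linear "proj J" by (rule bounded_linear_proj)
  have "proj J z = (\<Sum>e\<in>frame J. if z = e then e else 0)"
    unfolding proj_def using frame_orthonormal[OF J step(1)] by (intro sum.cong) auto
  also have "\<dots> = z" using step(1) by (simp add: frame_def)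
  finally show ?case using step by (simp add: add scaleR)
qed

text \<open>Composing with the projection turns the difference of two functions on a slice, of which
  only derivatives within the slice are known, into a cylindrical function on an open set of the
  whole algebra.\<close>
lemma slice_monogenic_cylinder:
  assumes J: "J \<in> torus v \<tau> t" and \<Omega>: "openin (top_of_set (span (v ` {..n}))) \<Omega>"
    and f: "slice_monogenic v \<tau> t J \<Omega> f" and g: "slice_monogenic v \<tau> t J \<Omega> g"
  shows "clifford_frame.monogenic (frame J) (proj J -` \<Omega>) (\<lambda>x. f (proj J x) - g (proj J x))"
proof -
  interpret clifford_frame "frame J" frame_conj by (rule clifford_frame_frame[OF J])
  interpret P: bounded_linear "proj J" by (rule bounded_linear_proj)
  let ?W = "span (frame J)" and ?S = "\<Omega> \<inter> span (frame J)" and ?U = "proj J -` \<Omega>"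
  let ?H = "\<lambda>x. f (proj J x) - g (proj J x)"
  have slice: "slice v \<tau> t J \<Omega> = ?S" by (simp add: slice_def span_frame)
  have contP: "continuous_on A (proj J)" for A
    by (rule linear_continuous_on[OF bounded_linear_proj])
  have "frame J \<subseteq> span (v ` {..n})"
  proof
    fix e assume e: "e \<in> frame J"
    show "e \<in> span (v ` {..n})"
    proof (cases "e = 1")
      case True
      then show ?thesis using v0 by (metis atMost_iff imageI le0 span_base)
    next
      case False
      then show ?thesis
        using imaginary_frame[OF J e] span_mono[of "v ` {1..n}" "v ` {..n}"] by (auto simp: image_mono)
    qed
  qed
  then have WV: "?W \<subseteq> span (v ` {..n})" by (metis span_minimal subspace_span)
  obtain O' where O': "open O'" "\<Omega> = span (v ` {..n}) \<inter> O'"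
    using \<Omega> by (auto simp: openin_open)
  have U: "?U = proj J -` O'" using O'(2) proj_in_span WV by blast
  then have openU: "open ?U" using O'(1) contP by (simp add: open_vimage)
  have PU: "proj J x \<in> ?S" if "x \<in> ?U" for x using that proj_in_span by simp
  obtain Df where Df: "\<And>x. x \<in> ?S \<Longrightarrow> (f has_derivative Df x) (at x within ?S)"
    "\<And>w. w \<in> ?W \<Longrightarrow> continuous_on ?S (\<lambda>x. Df x w)"
    using f unfolding slice_monogenic_def C1_on_def slice by (auto simp: span_frame)
  obtain Dg where Dg: "\<And>x. x \<in> ?S \<Longrightarrow> (g has_derivative Dg x) (at x within ?S)"
    "\<And>w. w \<in> ?W \<Longrightarrow> continuous_on ?S (\<lambda>x. Dg x w)"
    using g unfolding slice_monogenic_def C1_on_def slice by (auto simp: span_frame)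
  \<comment> \<open>Along the line through \<open>x\<close> in direction \<open>w\<close> the slice contains an interval, so the
      derivative within the slice determines the partial derivative.\<close>
  have partial: "partial_deriv u w x = D w"
    if der: "(u has_derivative D) (at x within ?S)" and x: "x \<in> ?S" and w: "w \<in> ?W"
    for u :: "'a \<Rightarrow> 'a" and D w x
  proof -
    let ?l = "\<lambda>r. x + r *\<^sub>R w"
    have lW: "?l r \<in> ?W" for r using x w by (simp add: span_add span_scale)
    have ol: "open (?l -` O')" by (intro open_vimage O'(1) continuous_intros)
    have lS: "?l ` (?l -` O') \<subseteq> ?S" using lW WV O'(2) by blast
    have x0: "0 \<in> ?l -` O'" using x O'(2) by simp
    have "(?l has_derivative (\<lambda>h. h *\<^sub>R w)) (at 0 within ?l -` O')"
      by (auto intro!: derivative_eq_intros)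
    moreover have "(u has_derivative D) (at (?l 0) within ?l ` (?l -` O'))"
      using has_derivative_subset[OF der lS] by simp
    ultimately have "((\<lambda>r. u (?l r)) has_derivative (\<lambda>h. D (h *\<^sub>R w))) (at 0 within ?l -` O')"
      by (rule has_derivative_in_compose)
    then have "((\<lambda>r. u (?l r)) has_vector_derivative D w) (at 0)"
      using has_derivative_linear[OF der] at_within_open[OF x0 ol]
      by (simp add: has_vector_derivative_def linear_cmul)
    then show ?thesis unfolding partial_deriv_def by (rule vector_derivative_at)
  qed
  have dirac: "(\<Sum>e\<in>frame J. e * D e) = 0"
    if "slice_monogenic v \<tau> t J \<Omega> u" "(u has_derivative D) (at x within ?S)" "x \<in> ?S" for u D x
  proof -
    have "(\<Sum>e\<in>frame J. e * D e) = (\<Sum>e\<in>frame J. e * partial_deriv u e x)"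
      using partial[OF that(2,3)] by (intro sum.cong) (simp_all add: span_base)
    also have "\<dots> = slice_CR v \<tau> t J u x"
      unfolding slice_CR_def by (rule frame_sum[OF J])
    also have "\<dots> = 0" using that unfolding slice_monogenic_def slice by blast
    finally show ?thesis .
  qed
  define E where "E x w = Df (proj J x) (proj J w) - Dg (proj J x) (proj J w)" for x w
  have Hder: "(?H has_derivative E x) (at x)" if x: "x \<in> ?U" for x
  proof -
    have "((\<lambda>x. u (proj J x)) has_derivative (\<lambda>h. D (proj J h))) (at x)"
      if "(u has_derivative D) (at (proj J x) within ?S)" for u D
    proof -
      have "(u has_derivative D) (at (proj J x) within proj J ` ?U)"
        by (rule has_derivative_subset[OF that]) (use PU in auto)
      then have "((\<lambda>x. u (proj J x)) has_derivative (\<lambda>h. D (proj J h))) (at x within ?U)"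
        by (rule has_derivative_in_compose[OF P.has_derivative[OF has_derivative_ident]])
      then show ?thesis using at_within_open[OF x openU] by simp
    qed
    from has_derivative_diff[OF this[OF Df(1)] this[OF Dg(1)]] show ?thesis
      using PU[OF x] by (simp add: E_def[abs_def])
  qed
  define D where "D x = Blinfun (E x)" for x
  have D: "blinfun_apply (D x) = E x" if "x \<in> ?U" for x
    unfolding D_def by (rule bounded_linear_Blinfun_apply[OF has_derivative_bounded_linear[OF Hder[OF that]]])
  have Pe: "proj J e = e" if "e \<in> frame J" for e
    by (rule proj_eq_self[OF J span_base[OF that]])
  have "monogenic_deriv ?U ?H D"
    unfolding monogenic_deriv_def
  proof (intro conjI ballI allI)
    show "continuous_on ?U D"
    proof (rule continuous_on_blinfun_componentwise)
      fix i :: 'a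
      have "continuous_on ?U (\<lambda>x. E x i)"
        unfolding E_def
        by (intro continuous_on_diff continuous_on_compose2[OF Df(2)[OF proj_in_span] contP]
            continuous_on_compose2[OF Dg(2)[OF proj_in_span] contP]) (use PU in auto)
      then show "continuous_on ?U (\<lambda>x. D x i)"
        by (rule continuous_on_eq) (simp add: D)
    qed
    fix x assume x: "x \<in> ?U"
    show "(?H has_derivative D x) (at x)" using Hder[OF x] D[OF x] by simp
    show "(\<Sum>e\<in>frame J. e * D x e) = 0"
      using dirac[OF f Df(1)[OF PU[OF x]] PU[OF x]] dirac[OF g Dg(1)[OF PU[OF x]] PU[OF x]]
      by (simp add: D[OF x] E_def Pe right_diff_distrib sum_subtractf)
    fix w
    have "D x w = D x (proj J w)"
      by (simp add: D[OF x] E_def proj_eq_self[OF J proj_in_span])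
    also have "\<dots> = (\<Sum>e\<in>frame J. (w \<bullet> e) *\<^sub>R D x e)"
      by (simp add: proj_def blinfun.sum_right blinfun.scaleR_right)
    finally show "D x w = (\<Sum>e\<in>frame J. (w \<bullet> e) *\<^sub>R D x e)" .
  qed (rule openU)
  then show ?thesis unfolding monogenic_def by blast
qed

end

section \<open>The identity principle on all slices\<close>

context regular_setting
begin

text \<open>Any exponent strictly between \<open>t 0 + \<tau> - 1\<close> and \<open>t 0 + \<tau>\<close> separates the dimension of a
  proper zero set from that of \<open>E\<close>.\<close>
lemma slice_identity_hausdorff:
  assumes J: "J \<in> torus v \<tau> t" and \<Omega>: "openin (top_of_set (span (v ` {..n}))) \<Omega>"
    and conn: "connected (slice v \<tau> t J \<Omega>)"
    and f: "slice_monogenic v \<tau> t J \<Omega> f" and g: "slice_monogenic v \<tau> t J \<Omega> g"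
    and E: "E \<subseteq> slice v \<tau> t J \<Omega>" "hausdorff_dim E \<ge> of_nat (t 0 + \<tau>)" "\<And>x. x \<in> E \<Longrightarrow> f x = g x"
    and x: "x \<in> slice v \<tau> t J \<Omega>"
  shows "f x = g x"
proof (rule ccontr)
  assume neq: "f x \<noteq> g x"
  interpret clifford_frame "frame J" frame_conj by (rule clifford_frame_frame[OF J])
  let ?H = "\<lambda>x. f (proj J x) - g (proj J x)"
  have slice: "slice v \<tau> t J \<Omega> = \<Omega> \<inter> span (frame J)" by (simp add: slice_def span_frame)
  have P: "proj J y = y" if "y \<in> slice v \<tau> t J \<Omega>" for y
    using that proj_eq_self[OF J] by (simp add: slice)
  \<comment> \<open>Positive because \<open>t 0 + \<tau>\<close> is at least \<open>1\<close>.\<close>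
  define s where "s = real (t 0 + \<tau>) - 1 / 2"
  have s: "s > 0" using mirror_dim_pos by (simp add: s_def)
  have "hausdorff_measure s {y \<in> slice v \<tau> t J \<Omega>. ?H y = 0} = 0"
  proof (rule zero_set_null[OF slice_monogenic_cylinder[OF J \<Omega> f g] conn])
    show "slice v \<tau> t J \<Omega> \<subseteq> proj J -` \<Omega> \<inter> span (frame J)" using P by (auto simp: slice)
    show "?H x \<noteq> 0" using neq P[OF x] by simp
    show "real (card (frame J)) - 2 < s" by (simp add: card_frame[OF J] s_def)
  qed (rule x)
  then have "hausdorff_measure s E = 0"
    by (rule hausdorff_null_subset) (use E(1,3) P in auto)
  then have "hausdorff_dim E \<le> ennreal s"
    unfolding hausdorff_dim_def by (intro INF_lower) (use s in auto)
  then have "ennreal (real (t 0 + \<tau>)) \<le> ennreal s"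
    using E(2) by (simp add: ennreal_of_nat_eq_real_of_nat)
  then have "real (t 0 + \<tau>) \<le> s"
    by (subst (asm) ennreal_le_iff) (use s in auto)
  then show False by (simp add: s_def)
qed

text \<open>The slices of \<open>J\<close> and \<open>J'\<close> share the hyperplane of the second that is orthogonal to
  \<open>J' k\<close>. It contains the mirror, so the domain meets it.\<close>
lemma slice_identity_transfer:
  assumes J: "J \<in> torus v \<tau> t" and J': "J' \<in> torus v \<tau> t"
    and k: "k \<in> {1..\<tau>}" "\<And>h. h \<in> {1..\<tau>} \<Longrightarrow> h \<noteq> k \<Longrightarrow> J' h = J h"
    and \<Omega>: "openin (top_of_set (span (v ` {..n}))) \<Omega>"
    and mirror: "\<Omega> \<inter> mirror v t \<noteq> {}" and conn: "connected (slice v \<tau> t J' \<Omega>)"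
    and f: "slice_monogenic v \<tau> t J' \<Omega> f" and g: "slice_monogenic v \<tau> t J' \<Omega> g"
    and eq: "\<And>x. x \<in> slice v \<tau> t J \<Omega> \<Longrightarrow> f x = g x"
    and x: "x \<in> slice v \<tau> t J' \<Omega>"
  shows "f x = g x"
proof -
  interpret clifford_frame "frame J'" frame_conj by (rule clifford_frame_frame[OF J'])
  let ?H = "\<lambda>x. f (proj J' x) - g (proj J' x)"
  have slice: "slice v \<tau> t J \<Omega> = \<Omega> \<inter> span (frame J)" for J by (simp add: slice_def span_frame)
  have P: "proj J' y = y" if "y \<in> span (frame J')" for y
    using that by (rule proj_eq_self[OF J'])
  have "J' h \<in> frame J" if "h \<in> {1..\<tau>}" "h \<noteq> k" for h
    using k(2)[OF that] that(1) by (simp add: frame_def)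
  moreover have "v ` {..t 0} \<subseteq> frame J" by (simp add: frame_def)
  ultimately have sub: "frame J' - {J' k} \<subseteq> frame J" unfolding frame_def[of J'] by blast
  have sub': "v ` {..t 0} \<subseteq> frame J' - {J' k}"
    using mirror_torus_inner[OF J' k(1)] torus_inner[OF J' k(1) k(1)] by (force simp: frame_def)
  obtain p where p: "p \<in> \<Omega>" "p \<in> span (v ` {..t 0})"
    using mirror by (auto simp: mirror_def subspan_def atMost_atLeast0)
  have pW: "p \<in> span (frame J' - {J' k})" using p(2) span_mono[OF sub'] by blast
  have W: "span (frame J' - {J' k}) \<subseteq> span (frame J')" by (intro span_mono) auto
  have "?H x = 0"
  proof (rule hyperplane_identity[OF slice_monogenic_cylinder[OF J' \<Omega> f g] _ _ conn _ _ x])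
    show "J' k \<in> frame J'" using k(1) by (simp add: frame_def)
    show "?H y = 0" if "y \<in> proj J' -` \<Omega> \<inter> span (frame J' - {J' k})" for y
    proof -
      have "proj J' y = y" using that W P by blast
      moreover have "y \<in> span (frame J)" using that span_mono[OF sub] by blast
      ultimately show ?thesis using that eq[of y] by (simp add: slice)
    qed
    show "slice v \<tau> t J' \<Omega> \<subseteq> proj J' -` \<Omega>" using P by (auto simp: slice)
    show "p \<in> slice v \<tau> t J' \<Omega> \<inter> span (frame J' - {J' k})" using p pW W by (auto simp: slice)
  qed
  then show ?thesis using P x by (simp add: slice)
qed

text \<open>The tuples \<open>K m\<close> agree with \<open>J'\<close> in the first \<open>m\<close> entries and with \<open>J\<close> in the others. When
  \<open>\<tau> > 1\<close> this detour is essential: the intersection of the slices of \<open>J\<close> and \<open>J'\<close> may be the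
  mirror, whose codimension \<open>\<tau>\<close> is too large for uniqueness.\<close>
lemma slice_identity_all:
  assumes J: "J \<in> torus v \<tau> t" and J': "J' \<in> torus v \<tau> t"
    and \<Omega>: "openin (top_of_set (span (v ` {..n}))) \<Omega>"
    and mirror: "\<Omega> \<inter> mirror v t \<noteq> {}"
    and conn: "\<And>J. J \<in> torus v \<tau> t \<Longrightarrow> connected (slice v \<tau> t J \<Omega>)"
    and f: "T_regular v \<tau> t \<Omega> f" and g: "T_regular v \<tau> t \<Omega> g"
    and eq: "\<And>x. x \<in> slice v \<tau> t J \<Omega> \<Longrightarrow> f x = g x"
    and x: "x \<in> slice v \<tau> t J' \<Omega>"
  shows "f x = g x"
proof -
  define K where "K m h = (if h \<in> {1..m} then J' h else J h)" for m h
  have K: "K m \<in> torus v \<tau> t" if "m \<le> \<tau>" for m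
    using J J' that unfolding torus_def K_def by (auto simp: PiE_iff extensional_def)
  have "\<forall>x\<in>slice v \<tau> t (K m) \<Omega>. f x = g x" if "m \<le> \<tau>" for m
    using that
  proof (induction m)
    case 0
    have "K 0 = J" by (simp add: K_def fun_eq_iff)
    then show ?case using eq by simp
  next
    case (Suc m)
    have Km: "K m \<in> torus v \<tau> t" and KS: "K (Suc m) \<in> torus v \<tau> t"
      using K[of m] K[of "Suc m"] Suc.prems by simp_all
    have "f x = g x" if x: "x \<in> slice v \<tau> t (K (Suc m)) \<Omega>" for x
    proof (rule slice_identity_transfer[OF Km KS _ _ \<Omega> mirror conn[OF KS], where k = "Suc m" and f = f and g = g and x = x])
      show "slice_monogenic v \<tau> t (K (Suc m)) \<Omega> f" "slice_monogenic v \<tau> t (K (Suc m)) \<Omega> g"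
        using f g KS by (auto simp: T_regular_def)
      show "Suc m \<in> {1..\<tau>}" using Suc.prems by simp
      show "K (Suc m) h = K m h" if "h \<in> {1..\<tau>}" "h \<noteq> Suc m" for h
        using that by (auto simp: K_def)
      show "f y = g y" if "y \<in> slice v \<tau> t (K m) \<Omega>" for y
        using Suc that by simp
    qed (rule x)
    then show ?case by blast
  qed
  moreover have "K \<tau> = J'"
  proof
    fix h
    show "K \<tau> h = J' h" using J J' by (auto simp: K_def torus_def PiE_iff extensional_def)
  qed
  ultimately show ?thesis using x by auto
qed

text \<open>Normalise the component in each block. Where it is zero, any unit vector of the block will
  do, and there is one because the steps increase strictly.\<close>
lemma slices_cover:
  assumes x: "x \<in> span (v ` {..n})"
  shows "\<exists>J\<in>torus v \<tau> t. x \<in> slice_space v \<tau> t J"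
proof -
  have inj: "inj_on v {..n}"
  proof (rule inj_onI)
    fix i j assume "i \<in> {..n}" "j \<in> {..n}" "v i = v j"
    then show "i = j" using orthonormal_v[of i j] orthonormal_v[of i i] by (auto split: if_splits)
  qed
  have "\<exists>a. x = (\<Sum>i\<le>n. a i *\<^sub>R v i)"
    using x by (force simp: span_finite sum.reindex[OF inj])
  then obtain a where a: "x = (\<Sum>i\<le>n. a i *\<^sub>R v i)" by blast
  define y where "y h = (\<Sum>i\<in>block h. a i *\<^sub>R v i)" for h
  define J where "J = restrict (\<lambda>h. if y h = 0 then v (t h) else y h /\<^sub>R norm (y h)) {1..\<tau>}"
  have J: "J \<in> torus v \<tau> t"
    unfolding torus_def
  proof (rule PiE_I)
    fix h assume h: "h \<in> {1..\<tau>}"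
    have "y h \<in> span (v ` block h)"
      unfolding y_def by (intro span_sum span_scale span_base) auto
    moreover have "v (t h) \<in> span (v ` block h)" using block_ne[OF h] by (intro span_base) auto
    moreover have "norm (v (t h)) = 1" using orthonormal_v[of "t h" "t h"] step_le[of h] h by (simp add: norm_eq_1)
    ultimately show "J h \<in> subsphere v (t (h - 1) + 1) (t h)"
      using h by (auto simp: J_def subsphere_def subspan_def span_scale)
  qed (auto simp: J_def)
  have y: "y h = norm (y h) *\<^sub>R J h" if "h \<in> {1..\<tau>}" for h
    using that by (simp add: J_def)
  have part: "{..n} = {..t 0} \<union> (\<Union>h\<in>{1..\<tau>}. block h)"
    using blocks_cover[of \<tau>] steps by (simp add: step_list_def)
  have dis: "{..t 0} \<inter> (\<Union>h\<in>{1..\<tau>}. block h) = {}"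
    using block_subset by force
  have "x = (\<Sum>i\<le>t 0. a i *\<^sub>R v i) + (\<Sum>i\<in>(\<Union>h\<in>{1..\<tau>}. block h). a i *\<^sub>R v i)"
    unfolding a part by (rule sum.union_disjoint) (use dis in auto)
  also have "(\<Sum>i\<in>(\<Union>h\<in>{1..\<tau>}. block h). a i *\<^sub>R v i) = (\<Sum>h=1..\<tau>. y h)"
    unfolding y_def by (rule sum.UNION_disjoint) (use block_disjoint in auto)
  finally have "x = (\<Sum>i\<le>t 0. a i *\<^sub>R v i) + (\<Sum>h=1..\<tau>. norm (y h) *\<^sub>R J h)"
    using y by simp
  then have "x \<in> slice_space v \<tau> t J"
    unfolding slice_space_def
    by (auto intro!: span_add span_sum span_scale intro: span_base)
  then show ?thesis using J by blast
qed

end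

theorem theorem7p3:
  fixes c :: "'a::{real_algebra_1,euclidean_space} \<Rightarrow> 'a"
    and V \<Omega> :: "'a set"
    and n d \<tau> :: nat
    and v :: "nat \<Rightarrow> 'a"
    and t :: "nat \<Rightarrow> nat"
    and f g :: "'a \<Rightarrow> 'a"
  assumes "star_involution c"
    and "imag_units c \<noteq> {}"
    and "hypercomplex_subspace c V"
    and "hypercomplex_basis c V n v"
    and "n \<le> d"
    and "orthonormal_basis d v"
    and "step_list n \<tau> t"
    and "slice_domain V v \<tau> t \<Omega>"
    and "T_regular v \<tau> t \<Omega> f"
    and "T_regular v \<tau> t \<Omega> g"
    and "\<exists>J \<in> torus v \<tau> t. \<exists>E \<subseteq> slice v \<tau> t J \<Omega>.
           hausdorff_dim E \<ge> of_nat (t 0 + \<tau>) \<and> (\<forall>x\<in>E. f x = g x)"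
  shows "\<forall>x\<in>\<Omega>. f x = g x"
proof
  have V: "V = span (v ` {..n})" and basis: "1 \<le> n" "v 0 = 1" "\<And>s. s \<in> {1..n} \<Longrightarrow> v s \<in> imag_units c"
    "\<And>s u. s \<in> {1..n} \<Longrightarrow> u \<in> {1..n} \<Longrightarrow> s \<noteq> u \<Longrightarrow> v s * v u = - (v u * v s)"
    using assms(4) unfolding hypercomplex_basis_def ordered_basis_def by blast+
  have square: "v s * v s = - 1" if "s \<in> {1..n}" for s
  proof -
    have "v s + c (v s) = 0" "v s * c (v s) = 1"
      using basis(3)[OF that] by (simp_all add: imag_units_def alg_trace_def alg_norm_def)
    then have "c (v s) = - v s" by (simp add: eq_neg_iff_add_eq_0 add.commute)
    then show ?thesis using \<open>v s * c (v s) = 1\<close> by (simp add: minus_equation_iff)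
  qed
  interpret regular_setting v n \<tau> t
  proof
    show "v i \<bullet> v j = (if i = j then 1 else 0)" if "i \<le> n" "j \<le> n" for i j
      using assms(5,6) that unfolding orthonormal_basis_def by simp
  qed (fact basis square assms(7))+
  have \<Omega>: "openin (top_of_set (span (v ` {..n}))) \<Omega>" and mirror: "\<Omega> \<inter> mirror v t \<noteq> {}"
    and conn: "\<And>J. J \<in> torus v \<tau> t \<Longrightarrow> connected (slice v \<tau> t J \<Omega>)"
    using assms(8) by (auto simp: slice_domain_def domain_in_def V)
  obtain J E where J: "J \<in> torus v \<tau> t" and E: "E \<subseteq> slice v \<tau> t J \<Omega>"
    "hausdorff_dim E \<ge> of_nat (t 0 + \<tau>)" "\<And>x. x \<in> E \<Longrightarrow> f x = g x"
    using assms(11) by blast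
  have eq: "f x = g x" if "x \<in> slice v \<tau> t J \<Omega>" for x
    by (rule slice_identity_hausdorff[where f = f and g = g and x = x, OF J \<Omega> conn[OF J] _ _ E that])
       (use assms(9,10) J in \<open>simp_all add: T_regular_def\<close>)
  fix x assume x: "x \<in> \<Omega>"
  then have "x \<in> span (v ` {..n})" using openin_imp_subset[OF \<Omega>] by blast
  then obtain J' where J': "J' \<in> torus v \<tau> t" "x \<in> slice v \<tau> t J' \<Omega>"
    using slices_cover x by (auto simp: slice_def)
  show "f x = g x"
    by (rule slice_identity_all[where f = f and g = g and x = x,
          OF J J'(1) \<Omega> mirror conn assms(9,10) eq J'(2)])
qed

end
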